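(* Let $K$ be an algebraically closed field of characteristic $0$, let $n\ge1$ be an integer and let $\ell_1,\dots,\ell_n\in\mathbb{Z}$. Then the projective subvariety $\mathcal{V}_{\ell_1,\dots,\ell_n}\subset\mathbb{P}^{n^2}_K$ defined in the context has degree $n!$.
   Context: Let $A=(A_{ij})_{1\le i,j\le n}$ be an $n\times n$ matrix of independent variables, and write $\det(XI_n-A)=X^n+a_1(A)X^{n-1}+\cdots+a_n(A)$, where $a_k\in\mathbb{Z}[(A_{ij})_{1\le i,j\le n}]$ is homogeneous of degree $k$. Let $Z$ be a further variable, and regard the $A_{ij}$ together with $Z$ as projective coordinates on $\mathbb{P}^{n^2}_K$. For $\ell_1,\dots,\ell_n\in K$, $\mathcal{V}_{\ell_1,\dots,\ell_n}\subset\mathbb{P}^{n^2}_K$ is cut out by the $n$ homogeneous polynomials $a_1(A)-\ell_1Z,\ a_2(A)-\ell_2Z^2,\ \dots,\ a_n(A)-\ell_nZ^n$. Integers are viewed as elements of $K$. *)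

theory Defs
  imports
    "HOL-Analysis.Determinants"
    "HOL-Computational_Algebra.Polynomial"
    "HOL-Library.Poly_Mapping"
begin

section \<open>Polynomials in several variables\<close>

text \<open>
  \<open>('v, 'k) mpoly\<close> is the polynomial ring \<open>'k['v]\<close> with variables indexed by the elements of
  \<open>'v\<close>: finitely supported families of coefficients, indexed by monomials, that is, by finitely
  supported families of exponents.  Its ring structure is the convolution product on
  \<open>poly_mapping\<close>.
\<close>

type_synonym ('v, 'k) mpoly = "('v \<Rightarrow>\<^sub>0 nat) \<Rightarrow>\<^sub>0 'k"

definition Const :: "'k::zero \<Rightarrow> ('v, 'k) mpoly"
  where "Const c = Poly_Mapping.single 0 c"

definition Var :: "'v \<Rightarrow> ('v, 'k::zero_neq_one) mpoly"
  where "Var v = Poly_Mapping.single (Poly_Mapping.single v 1) 1"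

definition monom_degree :: "('v \<Rightarrow>\<^sub>0 nat) \<Rightarrow> nat"
  where "monom_degree m = (\<Sum>v\<in>Poly_Mapping.keys m. Poly_Mapping.lookup m v)"

definition eval_mpoly :: "('v \<Rightarrow> 'k) \<Rightarrow> ('v, 'k::comm_ring_1) mpoly \<Rightarrow> 'k"
  where "eval_mpoly x f = (\<Sum>m\<in>Poly_Mapping.keys f. Poly_Mapping.lookup f m * (\<Prod>v\<in>Poly_Mapping.keys m. x v ^ Poly_Mapping.lookup m v))"

definition forms :: "nat \<Rightarrow> ('v, 'k::zero) mpoly set"
  where "forms d = {f. \<forall>m\<in>Poly_Mapping.keys f. monom_degree m = d}"

definition smult_mpoly :: "'k \<Rightarrow> ('v, 'k::comm_ring_1) mpoly \<Rightarrow> ('v, 'k) mpoly"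
  where "smult_mpoly c f = Const c * f"

lemma vector_space_smult_mpoly:
  "vector_space (smult_mpoly :: 'k::field \<Rightarrow> ('v, 'k) mpoly \<Rightarrow> ('v, 'k) mpoly)"
proof
  fix a b :: 'k and x y :: "('v, 'k) mpoly"
  show "smult_mpoly a (x + y) = smult_mpoly a x + smult_mpoly a y"
    by (simp add: smult_mpoly_def distrib_left)
  show "smult_mpoly (a + b) x = smult_mpoly a x + smult_mpoly b x"
    by (simp add: smult_mpoly_def Const_def Poly_Mapping.single_add distrib_right)
  show "smult_mpoly a (smult_mpoly b x) = smult_mpoly (a * b) x"
    by (simp add: smult_mpoly_def Const_def Poly_Mapping.mult_single flip: mult.assoc)
  show "smult_mpoly 1 x = x"
    by (simp add: smult_mpoly_def Const_def)
qed

lemma module_mpoly: "module ((*) :: ('v, 'k::comm_ring_1) mpoly \<Rightarrow> _)"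
  by standard (simp_all add: algebra_simps)


section \<open>Projective space, closed subsets and their degree\<close>

text \<open>
  A point of the projective space with homogeneous coordinates indexed by \<open>'v\<close> (of dimension
  \<open>CARD('v) - 1\<close>) is the set of all its coordinate vectors.
\<close>

definition proj_point :: "('v \<Rightarrow> 'k::field) \<Rightarrow> ('v \<Rightarrow> 'k) set"
  where "proj_point x = {y. \<exists>c. c \<noteq> 0 \<and> y = (\<lambda>v. c * x v)}"

definition proj_space :: "('v \<Rightarrow> 'k::field) set set"
  where "proj_space = {proj_point x | x. x \<noteq> (\<lambda>_. 0)}"

definition proj_zeros :: "('v, 'k::field) mpoly set \<Rightarrow> ('v \<Rightarrow> 'k) set set"
  where "proj_zeros F = {P \<in> proj_space. \<forall>f\<in>F. \<forall>x\<in>P. eval_mpoly x f = 0}"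

text \<open>
  The homogeneous vanishing ideal of \<open>Y\<close> is generated by the forms of all degrees vanishing on
  \<open>Y\<close>; \<open>module.span (*)\<close> is the ideal generated by a set.
\<close>

definition proj_ideal :: "('v \<Rightarrow> 'k::field) set set \<Rightarrow> ('v, 'k) mpoly set"
  where "proj_ideal Y =
    module.span (*) {f. (\<exists>d. f \<in> forms d) \<and> (\<forall>P\<in>Y. \<forall>x\<in>P. eval_mpoly x f = 0)}"

text \<open>
  For a homogeneous ideal \<open>I\<close> of \<open>S = 'k['v]\<close>, the Hilbert function of \<open>S/I\<close> is
  \<open>d \<mapsto> dim (S\<^sub>d / I\<^sub>d)\<close>; here \<open>'v\<close> is finite, so that \<open>S\<^sub>d\<close> is finite-dimensional.
\<close>

definition hilbert_function :: "('v::finite, 'k::field) mpoly set \<Rightarrow> nat \<Rightarrow> int"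
  where "hilbert_function I d =
    int (vector_space.dim smult_mpoly (forms d :: ('v, 'k) mpoly set))
    - int (vector_space.dim smult_mpoly (I \<inter> forms d))"

definition is_hilbert_polynomial :: "('v::finite, 'k::field) mpoly set \<Rightarrow> rat poly \<Rightarrow> bool"
  where "is_hilbert_polynomial I p \<longleftrightarrow>
    (\<exists>N. \<forall>d\<ge>N. poly p (of_nat d) = of_int (hilbert_function I d))"

lemma is_hilbert_polynomial_unique:
  assumes "is_hilbert_polynomial I p" "is_hilbert_polynomial I q"
  shows "p = q"
proof (rule ccontr)
  assume "p \<noteq> q"
  then have fin: "finite {x. poly (p - q) x = 0}"
    by (intro poly_roots_finite) simp
  obtain M N where "\<forall>d\<ge>M. poly p (of_nat d) = of_int (hilbert_function I d)"
    and "\<forall>d\<ge>N. poly q (of_nat d) = of_int (hilbert_function I d)"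
    using assms unfolding is_hilbert_polynomial_def by blast
  then have "of_nat ` {max M N..} \<subseteq> {x. poly (p - q) x = 0}"
    by auto
  then have "finite ((of_nat :: nat \<Rightarrow> rat) ` {max M N..})"
    using fin finite_subset by blast
  then have "finite {max M N..}"
    by (rule finite_imageD) (simp add: inj_on_def)
  then show False
    by (simp add: infinite_Ici)
qed

definition hilbert_polynomial :: "('v::finite, 'k::field) mpoly set \<Rightarrow> rat poly"
  where "hilbert_polynomial I = (THE p. is_hilbert_polynomial I p)"

text \<open>
  The degree of a closed subset \<open>Y\<close> is \<open>r!\<close> times the leading coefficient of the Hilbert
  polynomial of its homogeneous coordinate ring, where \<open>r\<close> (the dimension of \<open>Y\<close>) is the degree
  of that polynomial.
\<close>

definition proj_degree :: "('v::finite \<Rightarrow> 'k::field) set set \<Rightarrow> rat"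
  where "proj_degree Y =
    (let p = hilbert_polynomial (proj_ideal Y)
     in fact (Polynomial.degree p) * Polynomial.lead_coeff p)"


section \<open>Matrices with prescribed characteristic polynomial\<close>

text \<open>
  The homogeneous coordinates are the entries of an \<open>n \<times> n\<close> matrix, where \<open>n = CARD('n)\<close>,
  together with one further coordinate.
\<close>

datatype 'n coord = Entry 'n 'n | Z_coord

lemma UNIV_coord: "(UNIV :: 'n coord set) = insert Z_coord ((\<lambda>(i, j). Entry i j) ` UNIV)"
  by (auto simp: image_iff) (metis coord.exhaust)

instance coord :: (finite) finite
  by standard (simp add: UNIV_coord)

lemma card_coord: "CARD('n::finite coord) = CARD('n) ^ 2 + 1"
proof -
  have "inj (\<lambda>(i :: 'n, j). Entry i j)"
    by (auto simp: inj_on_def)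
  then show ?thesis
    by (subst UNIV_coord, subst card_insert_disjoint)
       (auto simp: card_image card_cartesian_product power2_eq_square simp flip: UNIV_Times_UNIV)
qed

definition generic_matrix :: "('n::finite coord, 'k::field) mpoly ^ 'n ^ 'n"
  where "generic_matrix = (\<chi> i j. Var (Entry i j))"

definition char_poly :: "'a::comm_ring_1 ^ 'n ^ 'n \<Rightarrow> 'a poly"
  where "char_poly A = det (mat [:0, 1:] - (\<chi> i j. [:A $ i $ j:]))"

definition a_coeff :: "nat \<Rightarrow> 'a::comm_ring_1 ^ 'n ^ 'n \<Rightarrow> 'a"
  where "a_coeff k A = poly.coeff (char_poly A) (CARD('n) - k)"

definition char_variety :: "(nat \<Rightarrow> int) \<Rightarrow> ('n::finite coord \<Rightarrow> 'k::field) set set"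
  where "char_variety l = proj_zeros
    {a_coeff k (generic_matrix :: ('n coord, 'k) mpoly ^ 'n ^ 'n)
       - Const (of_int (l k)) * Var Z_coord ^ k | k. k \<in> {1..CARD('n)}}"

end

theory Submission
  imports Defs "HOL-Computational_Algebra.Formal_Power_Series"
begin

text \<open>
  Order the indices as \<open>0, \<dots>, n - 1\<close>.  The ideal generated by the forms
  \<open>f\<^sub>k = a\<^sub>k - l\<^sub>k Z\<^sup>k\<close> is also generated by forms \<open>g\<^sub>i\<close> whose leading monomial, for a suitable weight, is
  the power \<open>i + 1\<close> of the diagonal variable \<open>A\<^sub>i\<^sub>i\<close>.  The products of the \<open>g\<^sub>i\<close> and of standard
  monomials, those in which the exponent of \<open>A\<^sub>i\<^sub>i\<close> is at most \<open>i\<close>, therefore form a basis of the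
  polynomial ring, and if \<open>(f\<^sub>k)\<close> is the full vanishing ideal, then the Hilbert function counts
  standard monomials.  There are \<open>1 \<cdot> 2 \<cdots> n\<close> choices for the bounded exponents, and the remaining
  \<open>n\<^sup>2 - n + 1\<close> variables are free.

  To see that a form \<open>p\<close> of degree \<open>d\<close> vanishing on the variety lies in the ideal, factor
  \<open>T\<^sup>n + l\<^sub>1 T\<^sup>n\<^sup>-\<^sup>1 + \<cdots> + l\<^sub>n\<close> as the product of the \<open>T - r\<^sub>k\<close>, and let \<open>D\<close> be the determinant of the vectors
  \<open>v\<^sub>0 = e\<^sub>0\<close>, \<open>v\<^sub>k\<^sub>+\<^sub>1 = (A - r\<^sub>k Z) v\<^sub>k\<close> for \<open>k < n\<close>.  By Cayley-Hamilton the last vector \<open>v\<^sub>n\<close> has entries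
  in the ideal.  Subtracting from \<open>D A\<close> a rank one matrix with column \<open>v\<^sub>n\<close> gives a matrix with
  eigenvalues \<open>r\<^sub>k Z D\<close>, that is, a point of the variety with last coordinate \<open>Z D\<close>.  Hence \<open>p\<close>
  vanishes there, and modulo the ideal this says that \<open>Z D\<^sup>d\<^sup>+\<^sup>1 p\<close> is zero.  The leading monomial of
  \<open>Z D\<^sup>d\<^sup>+\<^sup>1\<close> involves no diagonal variable, so multiplication by it preserves standard leading
  monomials and can be cancelled.
\<close>

abbreviation "lookup \<equiv> Poly_Mapping.lookup"
abbreviation "keys \<equiv> Poly_Mapping.keys"

section \<open>Homomorphisms of polynomial rings\<close>

text \<open>Determinants, characteristic polynomials and Krylov vectors are given by universal ring
  expressions, so they commute with ring homomorphisms. This is applied to evaluation, to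
  substitution, to \<open>Const\<close> and to the embedding of constants into univariate
  polynomials.\<close>

locale comm_ring_hom =
  fixes h :: "'a::comm_ring_1 \<Rightarrow> 'b::comm_ring_1"
  assumes hom_add: "h (x + y) = h x + h y"
    and hom_mult: "h (x * y) = h x * h y"
    and hom_one: "h 1 = 1"
begin

lemma hom_zero: "h 0 = 0"
  using hom_add[of 0 0] by simp

lemma hom_uminus: "h (- x) = - h x"
  using hom_add[of x "- x"] by (simp add: hom_zero eq_neg_iff_add_eq_0 add.commute)

lemma hom_diff: "h (x - y) = h x - h y"
  using hom_add[of x "- y"] by (simp add: hom_uminus)

lemma hom_sum: "h (sum f A) = (\<Sum>x\<in>A. h (f x))"
  by (induction A rule: infinite_finite_induct) (auto simp: hom_zero hom_add)

lemma hom_prod: "h (prod f A) = (\<Prod>x\<in>A. h (f x))"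
  by (induction A rule: infinite_finite_induct) (auto simp: hom_one hom_mult)

lemma hom_power: "h (x ^ n) = h x ^ n"
  by (induction n) (auto simp: hom_one hom_mult)

lemma hom_of_nat: "h (of_nat n) = of_nat n"
  by (induction n) (auto simp: hom_zero hom_one hom_add)

lemma hom_of_int: "h (of_int n) = of_int n"
  by (cases n) (auto simp: hom_of_nat hom_uminus hom_diff hom_one)

lemmas hom_simps = hom_zero hom_one hom_add hom_mult hom_uminus hom_diff hom_sum hom_prod
  hom_power hom_of_nat hom_of_int

lemma hom_det: "h (det A) = det (\<chi> i j. h (A $ i $ j))"
  by (simp add: det_def hom_simps)

lemma coeff_map_poly_hom: "poly.coeff (map_poly h p) k = h (poly.coeff p k)"
  by (simp add: coeff_map_poly hom_zero)

lemma comm_ring_hom_map_poly: "comm_ring_hom (map_poly h)"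
  by standard (auto intro!: poly_eqI
      simp: coeff_map_poly_hom coeff_mult hom_simps map_poly_1')

lemma hom_char_poly: "map_poly h (char_poly A) = char_poly (\<chi> i j. h (A $ i $ j))"
proof -
  interpret P: comm_ring_hom "map_poly h" by (rule comm_ring_hom_map_poly)
  have "map_poly h [:a, b:] = [:h a, h b:]" for a b
    by (rule poly_eqI) (simp add: coeff_map_poly_hom coeff_pCons hom_simps split: nat.split)
  then show ?thesis
    unfolding char_poly_def P.hom_det
    by (intro arg_cong[of _ _ det])
       (auto simp: vec_eq_iff mat_def P.hom_simps hom_zero hom_one map_poly_pCons)
qed

lemma hom_a_coeff: "h (a_coeff k A) = a_coeff k (\<chi> i j. h (A $ i $ j))"
  unfolding a_coeff_def hom_char_poly[symmetric] coeff_map_poly_hom ..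

end

lemma comm_ring_hom_ident: "comm_ring_hom (\<lambda>x. x)"
  by standard auto

lemma comm_ring_hom_Const: "comm_ring_hom (Const :: 'k::comm_ring_1 \<Rightarrow> ('v, 'k) mpoly)"
  by standard (auto simp: Const_def single_add mult_single)

section \<open>Evaluation at points and substitution of polynomials\<close>

definition eval_monom :: "('v::finite \<Rightarrow> 'a::comm_ring_1) \<Rightarrow> ('v \<Rightarrow>\<^sub>0 nat) \<Rightarrow> 'a"
  where "eval_monom y m = (\<Prod>v\<in>UNIV. y v ^ lookup m v)"

text \<open>With \<open>c\<close> the identity this is evaluation at a point, with
  \<open>c = Const\<close> substitution of polynomials; the homomorphism property is proved once for
  both.\<close>

definition insertion :: "('k::comm_ring_1 \<Rightarrow> 'a::comm_ring_1) \<Rightarrow> ('v::finite \<Rightarrow> 'a) \<Rightarrow> ('v, 'k) mpoly \<Rightarrow> 'a"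
  where "insertion c y p = (\<Sum>m\<in>keys p. c (lookup p m) * eval_monom y m)"

lemma eval_monom_0 [simp]: "eval_monom y 0 = 1"
  by (simp add: eval_monom_def)

lemma eval_monom_add: "eval_monom y (m + m') = eval_monom y m * eval_monom y m'"
  by (simp add: eval_monom_def lookup_add power_add prod.distrib)

lemma eval_monom_single [simp]: "eval_monom y (Poly_Mapping.single v n) = y v ^ n"
proof -
  have "eval_monom y (Poly_Mapping.single v n) = (\<Prod>u\<in>UNIV. if u = v then y v ^ n else 1)"
    unfolding eval_monom_def by (intro prod.cong) (auto simp: lookup_single when_def)
  then show ?thesis by simp
qed

lemma monom_degree_altdef: "monom_degree (m :: 'v::finite \<Rightarrow>\<^sub>0 nat) = (\<Sum>v\<in>UNIV. lookup m v)"
  unfolding monom_degree_def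
  by (intro sum.mono_neutral_left) (auto simp: in_keys_iff)

lemma monom_degree_0 [simp]: "monom_degree 0 = 0"
  by (simp add: monom_degree_def)

lemma monom_degree_add:
  "monom_degree (m + m') = monom_degree m + monom_degree (m' :: 'v::finite \<Rightarrow>\<^sub>0 nat)"
  by (simp add: monom_degree_altdef lookup_add sum.distrib)

lemma monom_degree_single [simp]: "monom_degree (Poly_Mapping.single v n) = n"
  by (simp add: monom_degree_def)

lemma eval_monom_scale: "eval_monom (\<lambda>v. a * y v) m = a ^ monom_degree m * eval_monom y m"
  by (simp add: eval_monom_def monom_degree_altdef power_mult_distrib prod.distrib power_sum)

lemma insertion_superset:
  assumes "finite A" "keys p \<subseteq> A" "c 0 = 0"
  shows "insertion c y p = (\<Sum>m\<in>A. c (lookup p m) * eval_monom y m)"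
  unfolding insertion_def using assms
  by (intro sum.mono_neutral_left) (auto simp: in_keys_iff)

lemma mpoly_eq_sum_single: "(p :: 'a \<Rightarrow>\<^sub>0 'b::comm_monoid_add) = (\<Sum>m\<in>keys p. Poly_Mapping.single m (lookup p m))"
proof (rule poly_mapping_eqI)
  fix k
  have "(\<Sum>m\<in>keys p. lookup (Poly_Mapping.single m (lookup p m)) k) = (\<Sum>m\<in>keys p. if m = k then lookup p k else 0)"
    by (intro sum.cong) (auto simp: lookup_single when_def)
  also have "\<dots> = lookup p k"
    by (simp add: in_keys_iff)
  finally show "lookup p k = lookup (\<Sum>m\<in>keys p. Poly_Mapping.single m (lookup p m)) k"
    by (simp add: lookup_sum)
qed

lemma insertion_hom:
  assumes "comm_ring_hom c"
  shows "comm_ring_hom (insertion c y)"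
proof -
  interpret c: comm_ring_hom c by fact
  have add: "insertion c y (p + q) = insertion c y p + insertion c y q" for p q
  proof -
    have "insertion c y r = (\<Sum>m\<in>keys p \<union> keys q. c (lookup r m) * eval_monom y m)"
      if "keys r \<subseteq> keys p \<union> keys q" for r
      by (rule insertion_superset) (use that c.hom_zero in auto)
    from this[of p] this[of q] this[of "p + q"] keys_add[of p q] show ?thesis
      by (auto simp: lookup_add c.hom_add algebra_simps sum.distrib)
  qed
  have zero: "insertion c y 0 = 0" by (simp add: insertion_def)
  have sum: "insertion c y (sum f A) = (\<Sum>x\<in>A. insertion c y (f x))" for A :: "'z set" and f
    by (induction A rule: infinite_finite_induct) (auto simp: add zero)
  have single: "insertion c y (Poly_Mapping.single m a) = c a * eval_monom y m" for m a
    by (cases "a = 0") (auto simp: insertion_def c.hom_zero)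
  have mult: "insertion c y (p * q) = insertion c y p * insertion c y q" for p q
  proof -
    have "p * q = (\<Sum>m\<in>keys p. \<Sum>m'\<in>keys q. Poly_Mapping.single (m + m') (lookup p m * lookup q m'))"
      by (subst mpoly_eq_sum_single[of p], subst mpoly_eq_sum_single[of q])
         (simp add: sum_product mult_single)
    then have "insertion c y (p * q) = (\<Sum>m\<in>keys p. \<Sum>m'\<in>keys q. c (lookup p m) * eval_monom y m * (c (lookup q m') * eval_monom y m'))"
      by (simp add: sum single c.hom_mult eval_monom_add mult_ac)
    then show ?thesis
      by (simp add: insertion_def sum_product)
  qed
  have one: "insertion c y 1 = 1"
    using single[of 0 1] by (simp add: c.hom_one)
  show ?thesis by standard (fact add mult one)+
qed

lemma insertion_single:
  assumes "comm_ring_hom c"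
  shows "insertion c y (Poly_Mapping.single m a) = c a * eval_monom y m"
proof -
  interpret c: comm_ring_hom c by fact
  show ?thesis by (cases "a = 0") (auto simp: insertion_def c.hom_zero)
qed

lemma insertion_Const: "comm_ring_hom c \<Longrightarrow> insertion c y (Const a) = c a"
  by (simp add: Const_def insertion_single)

lemma insertion_Var: "comm_ring_hom c \<Longrightarrow> insertion c y (Var v) = y v"
  by (simp add: Var_def insertion_single comm_ring_hom.hom_one)

lemma eval_mpoly_eq_insertion: "eval_mpoly y p = insertion (\<lambda>x. x) y (p :: ('v::finite, 'k::comm_ring_1) mpoly)"
proof -
  have "(\<Prod>v\<in>keys m. y v ^ lookup m v) = eval_monom y m" for m :: "'v \<Rightarrow>\<^sub>0 nat"
    unfolding eval_monom_def by (intro prod.mono_neutral_left) (auto simp: in_keys_iff)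
  then show ?thesis by (simp add: eval_mpoly_def insertion_def)
qed

lemma comm_ring_hom_eval_mpoly: "comm_ring_hom (eval_mpoly (y :: 'v::finite \<Rightarrow> 'k::comm_ring_1))"
  using insertion_hom[OF comm_ring_hom_ident, of y]
  by (simp add: eval_mpoly_eq_insertion[abs_def])

lemma eval_mpoly_Const [simp]: "eval_mpoly (y :: 'v::finite \<Rightarrow> 'k::comm_ring_1) (Const a) = a"
  by (simp add: eval_mpoly_eq_insertion insertion_Const comm_ring_hom_ident)

lemma eval_mpoly_Var [simp]: "eval_mpoly (y :: 'v::finite \<Rightarrow> 'k::comm_ring_1) (Var v) = y v"
  by (simp add: eval_mpoly_eq_insertion insertion_Var comm_ring_hom_ident)

abbreviation subst_mpoly ::
    "('v::finite \<Rightarrow> ('w, 'k) mpoly) \<Rightarrow> ('v, 'k::comm_ring_1) mpoly \<Rightarrow> ('w, 'k) mpoly"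
  where "subst_mpoly \<equiv> insertion Const"

lemma comm_ring_hom_subst: "comm_ring_hom (subst_mpoly y)"
  by (rule insertion_hom[OF comm_ring_hom_Const])

lemma subst_mpoly_Const [simp]: "subst_mpoly y (Const a) = Const a"
  by (rule insertion_Const[OF comm_ring_hom_Const])

lemma subst_mpoly_Var [simp]: "subst_mpoly y (Var v) = y v"
  by (rule insertion_Var[OF comm_ring_hom_Const])

lemma eval_subst_mpoly:
  fixes x :: "'w::finite \<Rightarrow> 'k::comm_ring_1"
  shows "eval_mpoly x (subst_mpoly y p) = eval_mpoly (\<lambda>v. eval_mpoly x (y v)) p"
proof -
  interpret e: comm_ring_hom "eval_mpoly x" by (rule comm_ring_hom_eval_mpoly)
  show ?thesis
    unfolding eval_mpoly_eq_insertion[of _ p]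
    by (simp add: insertion_def e.hom_simps eval_monom_def)
qed

lemma Var_power: "(Var v ^ n :: ('v::finite, 'k::comm_ring_1) mpoly) = Poly_Mapping.single (Poly_Mapping.single v n) 1"
  by (induction n) (auto simp: Var_def mult_single single_add[symmetric])

lemma sum_single_lookup: "(\<Sum>v\<in>UNIV. Poly_Mapping.single v (lookup m v)) = (m :: 'v::finite \<Rightarrow>\<^sub>0 nat)"
  by (rule trans[OF sum.mono_neutral_right mpoly_eq_sum_single[symmetric]])
     (auto simp: in_keys_iff)

lemma eval_monom_Var: "eval_monom Var m = (Poly_Mapping.single m 1 :: ('v::finite, 'k::comm_ring_1) mpoly)"
proof -
  have "(\<Prod>v\<in>A. Poly_Mapping.single (F v) (1 :: 'k)) = Poly_Mapping.single (\<Sum>v\<in>A. F v) 1"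
    for A :: "'v set" and F :: "'v \<Rightarrow> ('v \<Rightarrow>\<^sub>0 nat)"
    by (induction A rule: infinite_finite_induct) (auto simp: mult_single)
  then show ?thesis by (simp add: eval_monom_def Var_power sum_single_lookup)
qed

lemma subst_mpoly_Var_eq: "subst_mpoly Var p = p" for p :: "('v::finite, 'k::comm_ring_1) mpoly"
proof -
  have "subst_mpoly Var p = (\<Sum>m\<in>keys p. Poly_Mapping.single m (lookup p m))"
    by (simp add: insertion_def eval_monom_Var Const_def mult_single)
  then show ?thesis by (simp flip: mpoly_eq_sum_single)
qed

section \<open>Forms\<close>

lemma forms_0 [simp]: "0 \<in> forms d"
  by (simp add: forms_def)

lemma forms_add: "p \<in> forms d \<Longrightarrow> q \<in> forms d \<Longrightarrow> p + q \<in> forms d"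
  using keys_add[of p q] by (auto simp: forms_def)

lemma forms_uminus: "p \<in> forms d \<Longrightarrow> - p \<in> forms (d :: nat)" for p :: "('v, 'k::comm_ring_1) mpoly"
  by (simp add: forms_def in_keys_iff lookup_uminus)

lemma forms_diff: "p \<in> forms d \<Longrightarrow> q \<in> forms d \<Longrightarrow> p - q \<in> forms d" for p :: "('v, 'k::comm_ring_1) mpoly"
  using forms_add[of p d "- q"] by (simp add: forms_uminus)

lemma forms_sum: "(\<And>x. x \<in> A \<Longrightarrow> f x \<in> forms d) \<Longrightarrow> sum f A \<in> forms d"
  by (induction A rule: infinite_finite_induct) (auto intro: forms_add)

lemma forms_mult:
  fixes p q :: "('v::finite, 'k::comm_ring_1) mpoly"
  assumes "p \<in> forms d" "q \<in> forms e"
  shows "p * q \<in> forms (d + e)"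
  using assms keys_mult[of p q] by (fastforce simp: forms_def monom_degree_add)

lemma forms_single: "Poly_Mapping.single m a \<in> forms (monom_degree m)"
  by (auto simp: forms_def)

lemma forms_Const: "Const a \<in> forms 0"
  using forms_single[of 0 a] by (simp add: Const_def)

lemma forms_1: "(1 :: ('v, 'k::comm_ring_1) mpoly) \<in> forms 0"
  by (simp add: forms_def)

lemma forms_Var: "Var v \<in> forms 1"
  using forms_single[of "Poly_Mapping.single v 1" 1] by (simp add: Var_def)

lemma forms_power:
  fixes p :: "('v::finite, 'k::comm_ring_1) mpoly"
  shows "p \<in> forms d \<Longrightarrow> p ^ n \<in> forms (n * d)"
  by (induction n) (auto simp: forms_1 intro: forms_mult)

lemma forms_prod:
  fixes f :: "'a \<Rightarrow> ('v::finite, 'k::comm_ring_1) mpoly"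
  assumes "\<And>x. x \<in> A \<Longrightarrow> f x \<in> forms (e x)"
  shows "prod f A \<in> forms (sum e A)"
  using assms by (induction A rule: infinite_finite_induct) (auto simp: forms_1 intro: forms_mult)

lemma eval_mpoly_scale_form:
  fixes y :: "'v::finite \<Rightarrow> 'k::comm_ring_1"
  assumes "p \<in> forms d"
  shows "eval_mpoly (\<lambda>v. a * y v) p = a ^ d * eval_mpoly y p"
  using assms
  by (auto simp: eval_mpoly_eq_insertion insertion_def eval_monom_scale forms_def sum_distrib_left mult_ac
      intro!: sum.cong)

lemma subst_mpoly_scale_form:
  assumes "p \<in> forms d"
  shows "subst_mpoly (\<lambda>v. a * y v) p = a ^ d * subst_mpoly y p"
  using assms
  by (auto simp: insertion_def eval_monom_scale forms_def sum_distrib_left mult_ac intro!: sum.cong)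

lemma forms_0_eq_Const:
  assumes "p \<in> forms 0"
  shows "p = Const (eval_mpoly (\<lambda>_. 0) (p :: ('v::finite, 'k::comm_ring_1) mpoly))"
proof -
  have "keys p \<subseteq> {0}"
    using assms by (auto simp: forms_def monom_degree_altdef intro!: poly_mapping_eqI)
  then have "p = Poly_Mapping.single 0 (lookup p 0)"
    by (intro poly_mapping_eqI) (auto simp: lookup_single when_def in_keys_iff)
  then have "p = Const (lookup p 0)" by (simp add: Const_def)
  then show ?thesis by (metis eval_mpoly_Const)
qed

section \<open>Polynomials vanishing everywhere\<close>

text \<open>Induction on the set of variables. With the other values fixed, the sum is a univariate
  polynomial in the value of \<open>u\<close> that vanishes on an infinite domain, so each of its
  coefficients vanishes. Monomials with the same exponent at \<open>u\<close> are still separated by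
  the remaining variables, which is why the third hypothesis is carried along.\<close>

lemma sum_monomials_eq_0:
  fixes c :: "('v \<Rightarrow>\<^sub>0 nat) \<Rightarrow> 'k::{idom, ring_char_0}"
  assumes "finite V" "finite M"
    and "\<And>m m'. m \<in> M \<Longrightarrow> m' \<in> M \<Longrightarrow> (\<forall>v\<in>V. lookup m v = lookup m' v) \<Longrightarrow> m = m'"
    and "\<And>x. (\<Sum>m\<in>M. c m * (\<Prod>v\<in>V. x v ^ lookup m v)) = 0" and "m \<in> M"
  shows "c m = 0"
  using assms
proof (induction V arbitrary: M m rule: finite_induct)
  case empty
  then have "M = {m}" by auto
  then show ?case using empty(3) by simp
next
  case (insert u V)
  define Mj where "Mj j = {m \<in> M. lookup m u = j}" for j
  have *: "(\<Sum>m\<in>Mj j. c m * (\<Prod>v\<in>V. x v ^ lookup m v)) = 0" for x j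
  proof -
    define P where "P = (\<Sum>m\<in>M. Polynomial.monom (c m * (\<Prod>v\<in>V. x v ^ lookup m v)) (lookup m u))"
    have "poly P t = 0" for t
    proof -
      have "poly P t = (\<Sum>m\<in>M. c m * (\<Prod>v\<in>insert u V. (x(u := t)) v ^ lookup m v))"
        unfolding P_def poly_sum poly_monom
      proof (intro sum.cong refl)
        fix m
        have "(\<Prod>v\<in>V. (x(u := t)) v ^ lookup m v) = (\<Prod>v\<in>V. x v ^ lookup m v)"
          using insert.hyps by (intro prod.cong) auto
        then show "c m * (\<Prod>v\<in>V. x v ^ lookup m v) * t ^ lookup m u =
            c m * (\<Prod>v\<in>insert u V. (x(u := t)) v ^ lookup m v)"
          using insert.hyps by (simp add: mult_ac)
      qed
      also have "\<dots> = 0" by (rule insert.prems(3))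
      finally show ?thesis .
    qed
    then have "P = 0" using poly_all_0_iff_0 by blast
    then have "0 = poly.coeff P j" by simp
    also have "\<dots> = (\<Sum>m\<in>M. if lookup m u = j then c m * (\<Prod>v\<in>V. x v ^ lookup m v) else 0)"
      unfolding P_def coeff_sum by (intro sum.cong) auto
    also have "\<dots> = (\<Sum>m\<in>Mj j. c m * (\<Prod>v\<in>V. x v ^ lookup m v))"
      using insert.prems(1) by (simp add: sum.If_cases Mj_def Int_def)
    finally show ?thesis by simp
  qed
  show ?case
  proof (rule insert.IH[of "Mj (lookup m u)"])
    show "finite (Mj (lookup m u))" using insert.prems(1) by (simp add: Mj_def)
    show "m1 = m2" if "m1 \<in> Mj (lookup m u)" "m2 \<in> Mj (lookup m u)"
      "\<forall>v\<in>V. lookup m1 v = lookup m2 v" for m1 m2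
      using that insert.prems(2)[of m1 m2] by (auto simp: Mj_def)
  qed (use * insert.prems in \<open>auto simp: Mj_def\<close>)
qed

text \<open>Later this turns vanishing at all points of affine space into a polynomial identity, at
  the place where one might expect the Nullstellensatz.\<close>

lemma mpoly_eq_0_if_eval_eq_0:
  fixes p :: "('v::finite, 'k::{idom, ring_char_0}) mpoly"
  assumes "\<And>x. eval_mpoly x p = 0"
  shows "p = 0"
proof -
  have "m \<notin> keys p" for m
  proof
    assume m: "m \<in> keys p"
    then have "lookup p m = 0"
    by (rule sum_monomials_eq_0[of UNIV "keys p" "lookup p" m, rotated -1])
       (use assms in \<open>auto intro!: poly_mapping_eqI
          simp: eval_mpoly_eq_insertion insertion_def eval_monom_def\<close>)
    with m show False by (simp add: in_keys_iff)
  qed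
  then have "keys p = {}" by blast
  then show ?thesis by simp
qed

section \<open>Dominant monomials\<close>

interpretation coeff_space: vector_space "smult_mpoly :: 'k::field \<Rightarrow> ('v, 'k) mpoly \<Rightarrow> ('v, 'k) mpoly"
  by (rule vector_space_smult_mpoly)

interpretation ideal: module "(*) :: ('v, 'k::comm_ring_1) mpoly \<Rightarrow> _"
  by (rule module_mpoly)

definition weight :: "('v::finite \<Rightarrow> nat) \<Rightarrow> ('v \<Rightarrow>\<^sub>0 nat) \<Rightarrow> nat"
  where "weight W m = (\<Sum>v\<in>UNIV. W v * lookup m v)"

text \<open>A weight does not order monomials totally, so a leading monomial need not exist. Looking
  at the keys of the difference imposes two conditions at once: \<open>m\<close> has coefficient 1,
  since it is not lighter than itself, and all other monomials are strictly lighter.\<close>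

definition dominant :: "('v::finite \<Rightarrow> nat) \<Rightarrow> ('v, 'k::comm_ring_1) mpoly \<Rightarrow> ('v \<Rightarrow>\<^sub>0 nat) \<Rightarrow> bool"
  where "dominant W p m \<longleftrightarrow> (\<forall>m'\<in>keys (p - Poly_Mapping.single m 1). weight W m' < weight W m)"

lemma weight_0 [simp]: "weight W 0 = 0"
  by (simp add: weight_def)

lemma weight_add: "weight W (m + m') = weight W m + weight W m'"
  by (simp add: weight_def lookup_add algebra_simps sum.distrib)

lemma weight_single [simp]: "weight W (Poly_Mapping.single v n) = W v * n"
proof -
  have "weight W (Poly_Mapping.single v n) = (\<Sum>u\<in>UNIV. if u = v then W v * n else 0)"
    unfolding weight_def by (intro sum.cong) (auto simp: lookup_single when_def)
  then show ?thesis by simp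
qed

lemma dominant_lookup: "dominant W p m \<Longrightarrow> lookup p m = 1"
  by (auto simp: dominant_def in_keys_iff lookup_minus dest: bspec[of _ _ m])

lemma dominant_lookup_other:
  assumes "dominant W p m" "m' \<noteq> m" "weight W m \<le> weight W m'"
  shows "lookup p m' = 0"
  using assms by (auto simp: dominant_def in_keys_iff lookup_minus lookup_single dest: bspec[of _ _ m'])

lemma dominantI:
  assumes "lookup p m = 1" "\<And>m'. m' \<in> keys p \<Longrightarrow> m' \<noteq> m \<Longrightarrow> weight W m' < weight W m"
  shows "dominant W p m"
  using assms by (auto simp: dominant_def in_keys_iff lookup_minus lookup_single when_def split: if_splits)

lemma dominant_unique:
  fixes p :: "('v::finite, 'k::comm_ring_1) mpoly"
  assumes "dominant W p m" "dominant W p m'"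
  shows "m = m'"
  using dominant_lookup_other[OF assms(1), of m'] dominant_lookup_other[OF assms(2), of m]
    dominant_lookup[OF assms(1)] dominant_lookup[OF assms(2)]
  by (cases "weight W m \<le> weight W m'") auto

lemma dominant_1: "dominant W 1 0"
  by (simp add: dominant_def)

lemma dominant_Var: "dominant W (Var v) (Poly_Mapping.single v 1)"
  by (simp add: dominant_def Var_def)

text \<open>Split each factor into its dominant monomial and a lighter rest. The three other
  products are strictly lighter, and the dominant coefficient \<open>1 * 1\<close> cannot vanish,
  even in the presence of zero divisors.\<close>

lemma dominant_mult:
  fixes p q :: "('v::finite, 'k::comm_ring_1) mpoly"
  assumes "dominant W p m" "dominant W q n"
  shows "dominant W (p * q) (m + n)"
proof -
  define p' where "p' = p - Poly_Mapping.single m 1"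
  define q' where "q' = q - Poly_Mapping.single n 1"
  have pq: "p = Poly_Mapping.single m 1 + p'" "q = Poly_Mapping.single n 1 + q'"
    by (auto simp: p'_def q'_def)
  have "p * q - Poly_Mapping.single (m + n) 1 =
      Poly_Mapping.single m 1 * q' + p' * Poly_Mapping.single n 1 + p' * q'"
    by (simp add: pq algebra_simps mult_single)
  moreover have "weight W k < weight W (m + n)" if "k \<in> keys (Poly_Mapping.single m 1 * q')" for k
    using that assms(2) keys_mult[of "Poly_Mapping.single m (1 :: 'k)" q']
    by (fastforce simp: dominant_def q'_def weight_add)
  moreover have "weight W k < weight W (m + n)" if "k \<in> keys (p' * Poly_Mapping.single n 1)" for k
    using that assms(1) keys_mult[of p' "Poly_Mapping.single n (1 :: 'k)"]
    by (fastforce simp: dominant_def p'_def weight_add)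
  moreover have "weight W k < weight W (m + n)" if "k \<in> keys (p' * q')" for k
  proof -
    obtain a b where "k = a + b" "a \<in> keys p'" "b \<in> keys q'"
      using \<open>k \<in> _\<close> keys_mult[of p' q'] by auto
    then show ?thesis
      using assms by (auto simp: dominant_def p'_def q'_def weight_add intro: add_strict_mono)
  qed
  ultimately show ?thesis
    unfolding dominant_def using keys_add[of "Poly_Mapping.single m 1 * q' + p' * Poly_Mapping.single n 1" "p' * q'"]
      keys_add[of "Poly_Mapping.single m 1 * q'" "p' * Poly_Mapping.single n 1"]
    by (simp only:) blast
qed

lemma dominant_prod:
  fixes P :: "'a \<Rightarrow> ('v::finite, 'k::comm_ring_1) mpoly"
  assumes "\<And>x. x \<in> A \<Longrightarrow> dominant W (P x) (\<delta> x)"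
  shows "dominant W (prod P A) (sum \<delta> A)"
  using assms by (induction A rule: infinite_finite_induct) (auto simp: dominant_1 intro: dominant_mult)

lemma dominant_power:
  fixes p :: "('v::finite, 'k::comm_ring_1) mpoly"
  assumes "dominant W p m"
  shows "dominant W (p ^ n) (\<Sum>i<n. m)"
  using dominant_prod[of "{..<n}" W "\<lambda>_. p" "\<lambda>_. m"] assms by simp

lemma lookup_smult_mpoly [simp]: "lookup (smult_mpoly c p) m = c * lookup p m"
  unfolding smult_mpoly_def Const_def by (simp add: mult_map_scale_conv_mult[symmetric] map.rep_eq when_def)

text \<open>Take a heaviest \<open>m0\<close> among the monomials with nonzero coefficient. No other
  polynomial of the combination contains \<open>m0\<close>, so the coefficient of \<open>m0\<close>
  in the sum is \<open>c m0\<close>.\<close>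

lemma dominant_independent:
  fixes P :: "('v \<Rightarrow>\<^sub>0 nat) \<Rightarrow> ('v::finite, 'k::field) mpoly"
  assumes "finite B" and dom: "\<And>m. m \<in> B \<Longrightarrow> dominant W (P m) m"
    and sum: "(\<Sum>m\<in>B. smult_mpoly (c m) (P m)) = 0" and "m \<in> B"
  shows "c m = 0"
proof (rule ccontr)
  assume "c m \<noteq> 0"
  define S where "S = {m \<in> B. c m \<noteq> 0}"
  have S: "finite S" "S \<noteq> {}" using assms \<open>c m \<noteq> 0\<close> by (auto simp: S_def)
  have "Max (weight W ` S) \<in> weight W ` S" using S by (intro Max_in) auto
  then obtain m0 where m0: "m0 \<in> S" "weight W m0 = Max (weight W ` S)" by auto
  have max: "weight W k \<le> weight W m0" if "k \<in> S" for k
    unfolding m0(2) using S that by (intro Max_ge) auto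
  have "0 = lookup (\<Sum>m\<in>B. smult_mpoly (c m) (P m)) m0" by (simp add: sum)
  also have "\<dots> = (\<Sum>k\<in>B. c k * lookup (P k) m0)"
    by (simp add: lookup_sum)
  also have "\<dots> = (\<Sum>k\<in>{m0}. c k * lookup (P k) m0)"
  proof (intro sum.mono_neutral_right ballI)
    fix k assume k: "k \<in> B - {m0}"
    show "c k * lookup (P k) m0 = 0"
    proof (cases "c k = 0")
      case False
      then have "weight W k \<le> weight W m0" using k by (intro max) (simp add: S_def)
      then have "lookup (P k) m0 = 0"
        using k by (intro dominant_lookup_other[OF dom]) auto
      then show ?thesis by simp
    qed simp
  qed (use m0(1) assms(1) in \<open>auto simp: S_def\<close>)
  also have "\<dots> = c m0"
    using m0(1) dominant_lookup[OF dom, of m0] by (auto simp: S_def)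
  finally show False using m0(1) by (auto simp: S_def)
qed

definition monomials :: "nat \<Rightarrow> ('v \<Rightarrow>\<^sub>0 nat) set"
  where "monomials d = {m. monom_degree m = d}"

lemma finite_monomials: "finite (monomials d :: ('v::finite \<Rightarrow>\<^sub>0 nat) set)"
proof (rule finite_imageD)
  have "lookup m v \<le> d" if "monom_degree m = d" for m :: "'v \<Rightarrow>\<^sub>0 nat" and v
    using that member_le_sum[of v UNIV "lookup m"] by (simp add: monom_degree_altdef)
  then have "lookup ` monomials d \<subseteq> PiE (UNIV :: 'v set) (\<lambda>_. {..d})"
    by (auto simp: monomials_def PiE_def extensional_def)
  then show "finite (lookup ` (monomials d :: ('v \<Rightarrow>\<^sub>0 nat) set))"
    by (rule finite_subset) (intro finite_PiE finite, auto)
  show "inj_on lookup (monomials d)" by (auto intro!: inj_onI poly_mapping_eqI)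
qed

section \<open>Bases adapted to leading powers\<close>

text \<open>
  The value \<open>b v = 0\<close> means that \<open>v\<close> carries no generator; this relies on \<open>k div 0 = 0\<close> and
  \<open>k mod 0 = k\<close>.
\<close>

locale adapted_basis =
  fixes W :: "'v::finite \<Rightarrow> nat" and b :: "'v \<Rightarrow> nat" and g :: "'v \<Rightarrow> ('v, 'k::field) mpoly"
  assumes dom: "b v > 0 \<Longrightarrow> dominant W (g v) (Poly_Mapping.single v (b v))"
    and form: "b v > 0 \<Longrightarrow> g v \<in> forms (b v)"
begin

text \<open>In the monomial \<open>m\<close>, as many full powers \<open>Var v ^ b v\<close> as
  possible are replaced by \<open>g v\<close>. The dominant monomial remains \<open>m\<close>, and
  \<open>U m\<close> visibly lies in the ideal of the generators as soon as one replacement takes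
  place.\<close>

definition U :: "('v \<Rightarrow>\<^sub>0 nat) \<Rightarrow> ('v, 'k) mpoly"
  where "U m = (\<Prod>v\<in>UNIV. Var v ^ (lookup m v mod b v) * g v ^ (lookup m v div b v))"

definition standard :: "('v \<Rightarrow>\<^sub>0 nat) \<Rightarrow> bool"
  where "standard m \<longleftrightarrow> (\<forall>v. b v > 0 \<longrightarrow> lookup m v < b v)"

lemma standard_altdef: "standard m \<longleftrightarrow> (\<forall>v. lookup m v div b v = 0)"
  by (auto simp: standard_def div_eq_0_iff)

lemma sum_single_const: "(\<Sum>i<n. Poly_Mapping.single v (k :: nat)) = Poly_Mapping.single v (n * k)"
  by (induction n) (auto simp: single_add[symmetric] add.commute)

lemma dominant_U: "dominant W (U m) m"
proof -
  have "dominant W (U m) (\<Sum>v\<in>UNIV. Poly_Mapping.single v (lookup m v))"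
    unfolding U_def
  proof (rule dominant_prod)
    fix v
    have 1: "dominant W (Var v ^ k) (Poly_Mapping.single v k)" for k
      using dominant_power[OF dominant_Var, of W v k] by (simp only: sum_single_const mult_1_right)
    have 2: "dominant W (g v ^ (lookup m v div b v)) (Poly_Mapping.single v (lookup m v div b v * b v))"
    proof (cases "b v = 0")
      case False
      then show ?thesis using dominant_power[OF dom, of v] by (simp only: sum_single_const)
    qed (auto simp: dominant_1)
    show "dominant W (Var v ^ (lookup m v mod b v) * g v ^ (lookup m v div b v)) (Poly_Mapping.single v (lookup m v))"
      using dominant_mult[OF 1 2, of "lookup m v mod b v"]
      by (simp only: single_add[symmetric] mod_div_mult_eq)
  qed
  then show ?thesis by (simp only: sum_single_lookup)
qed

lemma forms_U: "U m \<in> forms (monom_degree m)"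
proof -
  have "U m \<in> forms (\<Sum>v\<in>UNIV. lookup m v mod b v * 1 + lookup m v div b v * b v)"
    unfolding U_def
  proof (rule forms_prod, rule forms_mult)
    fix v show "g v ^ (lookup m v div b v) \<in> forms (lookup m v div b v * b v)"
      by (cases "b v = 0") (auto intro: forms_power form forms_1)
    show "(Var v :: ('v, 'k) mpoly) ^ (lookup m v mod b v) \<in> forms (lookup m v mod b v * 1)"
      by (intro forms_power forms_Var)
  qed
  then show ?thesis by (simp add: monom_degree_altdef)
qed

lemma inj_U: "inj U"
  by (rule injI) (metis dominant_U dominant_unique)

text \<open>Adding \<open>b v\<close> to an exponent raises the quotient by one and keeps the
  remainder. Multiplication by a generator thus merely shifts the index of a basis element.\<close>

lemma U_add_generator:
  assumes "b v > 0"
  shows "U (m + Poly_Mapping.single v (b v)) = U m * g v"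
proof -
  have "U (m + Poly_Mapping.single v (b v)) = (\<Prod>u\<in>UNIV. Var u ^ (lookup m u mod b u) * g u ^ (lookup m u div b u) * (if u = v then g v else 1))"
    unfolding U_def using assms
    by (intro prod.cong) (auto simp: lookup_add lookup_single when_def)
  also have "\<dots> = U m * g v"
    by (simp add: prod.distrib U_def)
  finally show ?thesis .
qed

lemma not_standard_add_generator:
  "b v > 0 \<Longrightarrow> \<not> standard (m + Poly_Mapping.single v (b v))"
  by (auto simp: standard_def lookup_add intro!: exI[of _ v])

text \<open>Induction on the weight: \<open>U m\<close> differs from the monomial \<open>m\<close>
  by strictly lighter monomials of the same degree.\<close>

lemma single_in_span_U: "Poly_Mapping.single m 1 \<in> coeff_space.span (U ` monomials (monom_degree m))"
proof (induction "weight W m" arbitrary: m rule: less_induct)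
  case less
  define r where "r = U m - Poly_Mapping.single m 1"
  have form_r: "r \<in> forms (monom_degree m)"
    unfolding r_def by (intro forms_diff forms_U forms_single)
  have "Poly_Mapping.single k (lookup r k) \<in> coeff_space.span (U ` monomials (monom_degree m))" if k: "k \<in> keys r" for k
  proof -
    have "weight W k < weight W m" "monom_degree k = monom_degree m"
      using k dominant_U[of m] form_r by (auto simp: r_def dominant_def forms_def)
    from less[OF this(1)] this(2)
    have "smult_mpoly (lookup r k) (Poly_Mapping.single k 1) \<in> coeff_space.span (U ` monomials (monom_degree m))"
      by (auto intro: coeff_space.span_scale)
    then show ?thesis by (simp add: smult_mpoly_def Const_def mult_single)
  qed
  then have "r \<in> coeff_space.span (U ` monomials (monom_degree m))"
    by (subst mpoly_eq_sum_single) (rule coeff_space.span_sum)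
  moreover have "U m \<in> coeff_space.span (U ` monomials (monom_degree m))"
    by (rule coeff_space.span_base) (auto simp: monomials_def)
  ultimately have "U m - r \<in> coeff_space.span (U ` monomials (monom_degree m))"
    by (rule coeff_space.span_diff[rotated])
  then show ?case by (simp add: r_def)
qed

lemma single_in_span_U': "Poly_Mapping.single m a \<in> coeff_space.span (U ` monomials (monom_degree m))"
  using coeff_space.span_scale[OF single_in_span_U[of m], of a]
  by (simp add: smult_mpoly_def Const_def mult_single)

lemma form_in_span_U: "p \<in> forms d \<Longrightarrow> p \<in> coeff_space.span (U ` monomials d)"
  using single_in_span_U' by (subst mpoly_eq_sum_single, intro coeff_space.span_sum) (force simp: forms_def)

lemma in_span_range_U: "p \<in> coeff_space.span (range U)"
  by (subst mpoly_eq_sum_single, rule coeff_space.span_sum,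
      rule coeff_space.span_mono[THEN subsetD, OF _ single_in_span_U']) auto

lemma span_U_explicit:
  assumes "p \<in> coeff_space.span (U ` A)"
  obtains T c where "finite T" "T \<subseteq> A" "p = (\<Sum>m\<in>T. smult_mpoly (c m) (U m))"
proof -
  obtain t r where t: "finite t" "t \<subseteq> U ` A" "p = (\<Sum>a\<in>t. smult_mpoly (r a) a)"
    using assms unfolding coeff_space.span_explicit by blast
  then obtain T where T: "T \<subseteq> A" "finite T" "t = U ` T"
    by (meson finite_subset_image)
  have "p = (\<Sum>m\<in>T. smult_mpoly (r (U m)) (U m))"
    using t(3) unfolding T(3) by (subst (asm) sum.reindex) (auto intro: inj_on_subset[OF inj_U])
  with T show ?thesis by (intro that[of T "\<lambda>m. r (U m)"]) auto
qed

lemma independent_U: "\<not> coeff_space.dependent (U ` A)"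
  unfolding coeff_space.independent_explicit_finite_subsets
proof (intro allI impI ballI)
  fix S u x assume S: "S \<subseteq> U ` A" "finite S" "(\<Sum>v\<in>S. smult_mpoly (u v) v) = 0" "x \<in> S"
  then obtain T where T: "T \<subseteq> A" "finite T" "S = U ` T" by (meson finite_subset_image)
  then obtain m where m: "m \<in> T" "x = U m" using S(4) by auto
  have "(\<Sum>m\<in>T. smult_mpoly (u (U m)) (U m)) = 0"
    using S(3) unfolding T(3) by (subst (asm) sum.reindex) (auto intro: inj_on_subset[OF inj_U])
  from dominant_independent[OF T(2) dominant_U this m(1)] show "u x = 0" by (simp add: m)
qed

text \<open>An element of the ideal is a sum of products \<open>p * g v\<close>. Expand
  \<open>p\<close> in the basis \<open>U\<close>; each product of a basis element with
  \<open>g v\<close> is again a basis element, with a nonstandard index.\<close>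

lemma ideal_subset_span_nonstandard:
  "ideal.span (g ` {v. b v > 0}) \<subseteq> coeff_space.span (U ` {m. \<not> standard m})"
proof
  let ?J = "coeff_space.span (U ` {m. \<not> standard m})"
  have mult: "p * g v \<in> ?J" if v: "b v > 0" for p v
    using in_span_range_U[of p]
  proof (induction rule: coeff_space.span_induct_alt)
    case (step c x y)
    then obtain m where x: "x = U m" by auto
    have "U m * g v \<in> ?J"
      using v by (intro coeff_space.span_base) (auto simp flip: U_add_generator simp: not_standard_add_generator)
    then have "smult_mpoly c (U m * g v) + y * g v \<in> ?J"
      by (intro coeff_space.span_add coeff_space.span_scale step)
    moreover have "(smult_mpoly c x + y) * g v = smult_mpoly c (U m * g v) + y * g v"
      unfolding x smult_mpoly_def distrib_right mult.assoc ..
    ultimately show ?case by (simp only:)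
  qed (auto simp: coeff_space.span_zero)
  fix p assume "p \<in> ideal.span (g ` {v. b v > 0})"
  then show "p \<in> ?J"
  proof (induction rule: ideal.span_induct_alt)
    case (step c x y)
    then show ?case using coeff_space.span_add[OF mult] by blast
  qed (rule coeff_space.span_zero)
qed

lemma U_nonstandard_in_ideal:
  assumes "\<not> standard m"
  shows "U m \<in> ideal.span (g ` {v. b v > 0})"
proof -
  obtain v where v: "lookup m v div b v \<noteq> 0" using assms by (auto simp: standard_altdef)
  then have "b v > 0" by (cases "b v = 0") auto
  from v obtain n where n: "lookup m v div b v = Suc n" by (cases "lookup m v div b v") auto
  have "U m = (\<Prod>u\<in>UNIV - {v}. Var u ^ (lookup m u mod b u) * g u ^ (lookup m u div b u)) * Var v ^ (lookup m v mod b v) * g v ^ n * g v"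
    unfolding U_def by (subst prod.remove[of _ v]) (simp_all only: n power_Suc2 mult.assoc mult.commute finite iso_tuple_UNIV_I)
  moreover have "g v \<in> ideal.span (g ` {v. b v > 0})"
    using \<open>b v > 0\<close> by (intro ideal.span_base) auto
  ultimately show ?thesis by (simp only: ideal.span_scale)
qed

text \<open>In the application \<open>I\<close> is the full vanishing ideal, and \<open>red\<close>
  stands in for the inclusion of \<open>I\<close> in the ideal of the generators. Multiplication by
  \<open>Y\<close> keeps dominant monomials standard, so an element of \<open>I\<close> that is a
  combination of standard \<open>U m\<close> must vanish. Hence the nonstandard \<open>U m\<close>
  of degree \<open>d\<close> form a basis of the degree \<open>d\<close> part of
  \<open>I\<close>.\<close>

theorem hilbert_function_eq_card_standard:
  fixes I :: "('v, 'k) mpoly set"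
  assumes I: "ideal.subspace I" and gI: "\<And>v. b v > 0 \<Longrightarrow> g v \<in> I"
    and red: "\<And>p. p \<in> I \<inter> forms d \<Longrightarrow> \<exists>\<mu> Y. dominant W Y \<mu> \<and> (\<forall>v. b v > 0 \<longrightarrow> lookup \<mu> v = 0) \<and>
      Y * p \<in> ideal.span (g ` {v. b v > 0})"
  shows "hilbert_function I d = int (card {m \<in> monomials d. standard m})"
proof -
  let ?N = "{m \<in> monomials d. \<not> standard m}" and ?S = "{m \<in> monomials d. standard m}"
  have fin: "finite ?N" "finite ?S" using finite_monomials[of d] by auto
  have dim_forms: "coeff_space.dim (forms d :: ('v, 'k) mpoly set) = card (monomials d :: ('v \<Rightarrow>\<^sub>0 nat) set)"
  proof (rule coeff_space.dim_unique)
    show "U ` monomials d \<subseteq> forms d" using forms_U by (auto simp: monomials_def)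
    show "card (U ` monomials d) = card (monomials d :: ('v \<Rightarrow>\<^sub>0 nat) set)"
      by (intro card_image inj_on_subset[OF inj_U]) auto
  qed (use form_in_span_U independent_U in auto)
  have nonstd_I: "U m \<in> I" if "\<not> standard m" for m
    using U_nonstandard_in_ideal[OF that] ideal.span_minimal[OF _ I, of "g ` {v. b v > 0}"] gI by auto
  have dim_I: "coeff_space.dim (I \<inter> forms d) = card ?N"
  proof (rule coeff_space.dim_unique)
    show "U ` ?N \<subseteq> I \<inter> forms d" using forms_U nonstd_I by (auto simp: monomials_def)
    show "card (U ` ?N) = card ?N"
      by (intro card_image inj_on_subset[OF inj_U]) auto
    show "\<not> coeff_space.dependent (U ` ?N)" by (rule independent_U)
    show "I \<inter> forms d \<subseteq> coeff_space.span (U ` ?N)"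
    proof
      fix p assume p: "p \<in> I \<inter> forms d"
      then have "p \<in> coeff_space.span (U ` monomials d)" by (auto intro: form_in_span_U)
      then obtain T c where T: "finite T" "T \<subseteq> monomials d" and pT: "p = (\<Sum>m\<in>T. smult_mpoly (c m) (U m))"
        by (rule span_U_explicit)
      \<comment> \<open>The nonstandard part \<open>t\<close> of \<open>p\<close> lies in
        \<open>I\<close>, hence so does the standard part \<open>s\<close>; it remains to show that
        \<open>s\<close> is zero.\<close>
      define s where "s = (\<Sum>m\<in>{m\<in>T. standard m}. smult_mpoly (c m) (U m))"
      define t where "t = (\<Sum>m\<in>{m\<in>T. \<not> standard m}. smult_mpoly (c m) (U m))"
      have "p = t + s"
        unfolding pT s_def t_def using T(1)
        by (subst sum.union_disjoint[symmetric]) (auto intro!: sum.cong)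
      have t_span: "t \<in> coeff_space.span (U ` ?N)"
        unfolding t_def using T(2) by (intro coeff_space.span_sum coeff_space.span_scale coeff_space.span_base) auto
      have "t \<in> I" unfolding t_def smult_mpoly_def
        by (intro ideal.subspace_sum[OF I] ideal.subspace_scale[OF I] nonstd_I) auto
      moreover have "t \<in> forms d" unfolding t_def smult_mpoly_def
      proof (intro forms_sum)
        fix m assume "m \<in> {m \<in> T. \<not> standard m}"
        then have "monom_degree m = d" using T(2) by (auto simp: monomials_def)
        then show "Const (c m) * U m \<in> forms d"
          using forms_mult[OF forms_Const forms_U, of "c m" m] by simp
      qed
      moreover have "s = p - t" using \<open>p = t + s\<close> by simp
      ultimately have "s \<in> I \<inter> forms d"
        using p by (auto intro: forms_diff ideal.subspace_diff[OF I])
      then obtain \<mu> Y where \<mu>: "dominant W Y \<mu>" "\<And>v. b v > 0 \<Longrightarrow> lookup \<mu> v = 0"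
        and Y: "Y * s \<in> ideal.span (g ` {v. b v > 0})"
        using red[of s] by metis
      from Y obtain R e where R: "finite R" "R \<subseteq> {m. \<not> standard m}" and Ys: "Y * s = (\<Sum>m\<in>R. smult_mpoly (e m) (U m))"
        by (rule span_U_explicit[OF subsetD[OF ideal_subset_span_nonstandard]])
      let ?S = "{m\<in>T. standard m}"
      \<comment> \<open>The dominant monomials of \<open>Y * U m\<close> for standard
        \<open>m\<close>. They are standard again because \<open>\<mu>\<close> avoids the variables
        with a generator, so they are disjoint from the nonstandard set \<open>R\<close>.\<close>
      define B where "B = (+) \<mu> ` ?S"
      have B_std: "standard m" if "m \<in> B" for m
        using that \<mu>(2) by (auto simp: B_def standard_def lookup_add)
      \<comment> \<open>Both expansions of \<open>Y * s\<close>, one by the \<open>Y * U m\<close>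
        with \<open>m\<close> standard and one by nonstandard \<open>U m\<close>, become a single
        family indexed by dominant monomials. The difference of the two is a vanishing combination
        of this family, with coefficients \<open>a\<close>.\<close>
      define P where "P m = (if m \<in> B then Y * U (m - \<mu>) else U m)" for m
      define a where "a m = (if m \<in> B then c (m - \<mu>) else - e m)" for m
      have "c m = 0" if m: "m \<in> ?S" for m
      proof -
        have "a (\<mu> + m) = 0"
        proof (rule dominant_independent)
          show "finite (B \<union> R)" using T R by (auto simp: B_def)
          show "dominant W (P k) k" if "k \<in> B \<union> R" for k
            using that dominant_mult[OF \<mu>(1) dominant_U] dominant_U by (auto simp: P_def B_def)
          have "(\<Sum>m\<in>B \<union> R. smult_mpoly (a m) (P m)) = (\<Sum>m\<in>B. smult_mpoly (a m) (P m)) + (\<Sum>m\<in>R. smult_mpoly (a m) (P m))"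
          proof (rule sum.union_disjoint)
            show "finite B" using T(1) by (simp add: B_def)
            show "B \<inter> R = {}" using R(2) B_std by blast
          qed (rule R(1))
          also have "(\<Sum>m\<in>R. smult_mpoly (a m) (P m)) = (\<Sum>m\<in>R. smult_mpoly (- e m) (U m))"
            using B_std R by (intro sum.cong) (auto simp: P_def a_def)
          also have "\<dots> = - (Y * s)" unfolding Ys by (simp add: sum_negf)
          also have "(\<Sum>m\<in>B. smult_mpoly (a m) (P m)) = (\<Sum>m\<in>?S. smult_mpoly (a (\<mu> + m)) (P (\<mu> + m)))"
            unfolding B_def by (subst sum.reindex) (auto simp: inj_on_def)
          also have "\<dots> = (\<Sum>m\<in>?S. Y * smult_mpoly (c m) (U m))"
          proof (rule sum.cong)
            fix k assume "k \<in> ?S"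
            then have "\<mu> + k \<in> B" by (simp add: B_def)
            then show "smult_mpoly (a (\<mu> + k)) (P (\<mu> + k)) = Y * smult_mpoly (c k) (U k)"
              by (simp add: a_def P_def smult_mpoly_def mult.left_commute)
          qed simp
          also have "\<dots> = Y * s" by (simp add: s_def sum_distrib_left)
          finally show "(\<Sum>m\<in>B \<union> R. smult_mpoly (a m) (P m)) = 0" by simp
          show "\<mu> + m \<in> B \<union> R" using m by (auto simp: B_def)
        qed
        then show ?thesis using m by (auto simp: a_def B_def split: if_splits)
      qed
      then have "s = 0" by (simp add: s_def)
      then show "p \<in> coeff_space.span (U ` ?N)" using t_span \<open>p = t + s\<close> by simp
    qed
  qed
  have "card (monomials d :: ('v \<Rightarrow>\<^sub>0 nat) set) = card (?N \<union> ?S)" by (intro arg_cong[of _ _ card]) auto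
  also have "\<dots> = card ?N + card ?S" using fin by (intro card_Un_disjoint) auto
  finally show ?thesis
    by (simp add: hilbert_function_def dim_forms dim_I)
qed

end

section \<open>Counting monomials with bounded exponents\<close>

text \<open>As in \<open>adapted_basis\<close>, \<open>b v = 0\<close> means that there is no bound.
  Vanishing outside \<open>A\<close> makes a function determined by its values on \<open>A\<close>,
  so that functions can be counted.\<close>

definition exponents :: "('v \<Rightarrow> nat) \<Rightarrow> 'v set \<Rightarrow> nat \<Rightarrow> ('v \<Rightarrow> nat) set"
  where "exponents b A d =
    {f. (\<forall>v. v \<notin> A \<longrightarrow> f v = 0) \<and> (\<Sum>v\<in>A. f v) = d \<and> (\<forall>v\<in>A. b v > 0 \<longrightarrow> f v < b v)}"

lemma exponents_insert:
  assumes "finite A" "u \<notin> A"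
  shows "exponents b (insert u A) d =
    (\<Union>c\<in>{c. c \<le> d \<and> (b u > 0 \<longrightarrow> c < b u)}. (\<lambda>f. f(u := c)) ` exponents b A (d - c))" (is "?L = ?R")
proof (intro equalityI subsetI)
  fix f assume f: "f \<in> ?L"
  then have *: "(\<Sum>v\<in>A. f v) = d - f u" "f u \<le> d" "b u > 0 \<longrightarrow> f u < b u"
    using assms by (auto simp: exponents_def)
  have "(\<Sum>v\<in>A. (f(u := 0)) v) = (\<Sum>v\<in>A. f v)"
    using assms by (intro sum.cong) auto
  then have "f(u := 0) \<in> exponents b A (d - f u)"
    using f * assms by (auto simp: exponents_def)
  then have "(f(u := 0))(u := f u) \<in> (\<lambda>h. h(u := f u)) ` exponents b A (d - f u)"
    by (rule imageI)
  then show "f \<in> ?R" using * by auto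
next
  fix f assume "f \<in> ?R"
  then obtain c h where ch: "c \<le> d" "b u > 0 \<longrightarrow> c < b u" "f = h(u := c)" "h \<in> exponents b A (d - c)"
    by auto
  have "(\<Sum>v\<in>A. f v) = (\<Sum>v\<in>A. h v)"
    using assms ch by (intro sum.cong) auto
  then show "f \<in> ?L"
    using ch assms by (auto simp: exponents_def)
qed

lemma finite_exponents: "finite A \<Longrightarrow> finite (exponents b A d)"
proof (induction A arbitrary: d rule: finite_induct)
  case empty
  have "exponents b {} d \<subseteq> {\<lambda>_. 0}" by (auto simp: exponents_def)
  then show ?case by (rule finite_subset) simp
qed (auto simp: exponents_insert)

lemma card_exponents_insert:
  assumes "finite A" "u \<notin> A"
  shows "card (exponents b (insert u A) d) =
    (\<Sum>c | c \<le> d \<and> (b u > 0 \<longrightarrow> c < b u). card (exponents b A (d - c)))"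
proof -
  have inj: "inj_on (\<lambda>f. f(u := c)) (exponents b A e)" for c e
  proof (rule inj_onI)
    fix f g assume *: "f \<in> exponents b A e" "g \<in> exponents b A e" "f(u := c) = g(u := c)"
    show "f = g"
    proof
      fix v show "f v = g v"
        using * assms by (cases "v = u") (auto simp: exponents_def dest: fun_cong[of _ _ v])
    qed
  qed
  have "card (exponents b (insert u A) d) =
    (\<Sum>c | c \<le> d \<and> (b u > 0 \<longrightarrow> c < b u). card ((\<lambda>f. f(u := c)) ` exponents b A (d - c)))"
    unfolding exponents_insert[OF assms]
  proof (rule card_UN_disjoint)
    show "\<forall>i\<in>{c. c \<le> d \<and> (0 < b u \<longrightarrow> c < b u)}. \<forall>j\<in>{c. c \<le> d \<and> (0 < b u \<longrightarrow> c < b u)}. i \<noteq> j \<longrightarrow>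
        (\<lambda>f. f(u := i)) ` exponents b A (d - i) \<inter> (\<lambda>f. f(u := j)) ` exponents b A (d - j) = {}"
      by (auto dest: fun_cong[of _ _ u])
  qed (use assms in \<open>auto simp: finite_exponents\<close>)
  then show ?thesis by (simp add: card_image[OF inj])
qed

text \<open>Stars and bars: a further free variable replaces the count by its partial sums, which
  the rising sum of binomial coefficients evaluates.\<close>

lemma card_exponents_free:
  assumes "finite A" "A \<noteq> {}" "\<And>v. v \<in> A \<Longrightarrow> b v = 0"
  shows "card (exponents b A d) = (d + (card A - 1)) choose (card A - 1)"
  using assms
proof (induction A arbitrary: d rule: finite_ne_induct)
  case (singleton v)
  then have "exponents b {v} d = {(\<lambda>_. 0)(v := d)}"
    by (auto simp: exponents_def fun_eq_iff)
  then show ?case by simp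
next
  case (insert v A)
  obtain r where r: "card A = Suc r" using insert by (cases "card A") auto
  have "card (exponents b (insert v A) d) = (\<Sum>c\<le>d. card (exponents b A (d - c)))"
    using insert.prems by (subst card_exponents_insert) (auto simp: insert.hyps atMost_def)
  also have "\<dots> = (\<Sum>c\<le>d. card (exponents b A c))"
    by (rule sum.reindex_bij_witness[of _ "\<lambda>c. d - c" "\<lambda>c. d - c"]) auto
  also have "\<dots> = (\<Sum>c\<le>d. (r + c) choose r)"
    using insert by (simp add: r add.commute)
  also have "\<dots> = (r + d + 1) choose (r + 1)"
    by (rule choose_rising_sum)
  finally show ?case using insert.hyps by (simp add: r add_ac)
qed

text \<open>The binomial coefficient \<open>(X + r) choose r\<close> as a polynomial in
  \<open>X\<close>.\<close>

definition shift_poly :: "nat \<Rightarrow> rat poly"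
  where "shift_poly r = smult (1 / fact r) (\<Prod>i<r. [:of_nat (Suc i), 1:])"

lemma degree_shift_poly: "degree (shift_poly r) = r"
  unfolding shift_poly_def by (simp add: degree_prod_eq_sum_degree)

lemma lead_coeff_shift_poly: "lead_coeff (shift_poly r) = 1 / fact r"
  unfolding shift_poly_def by (simp add: lead_coeff_prod del: of_nat_Suc)

lemma poly_shift_poly: "poly (shift_poly r) (of_nat d) = of_nat ((d + r) choose r)"
proof -
  have "poly (shift_poly r) (of_nat d) = pochhammer (of_nat d + 1) r / fact r"
    unfolding shift_poly_def pochhammer_prod by (simp add: poly_prod add_ac atLeast0LessThan)
  also have "\<dots> = of_nat (d + r) gchoose r"
    by (simp add: gbinomial_pochhammer')
  finally show ?thesis by (simp add: binomial_gbinomial)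
qed

text \<open>A further variable bounded by \<open>b u\<close> replaces the counting polynomial
  \<open>p\<close> by the sum of its shifts \<open>p(X - c)\<close> over \<open>c < b u\<close>.
  This keeps the degree and multiplies the leading coefficient by \<open>b u\<close>.\<close>

lemma card_exponents_poly:
  fixes b :: "'v \<Rightarrow> nat"
  assumes "finite A" "A \<noteq> {}" "\<And>v. v \<in> A \<Longrightarrow> b v = 0" "finite B" "\<And>v. v \<in> B \<Longrightarrow> b v > 0"
  shows "\<exists>p :: rat poly. degree p = card A - 1 \<and> lead_coeff p = (\<Prod>v\<in>B. of_nat (b v)) / fact (card A - 1) \<and>
    (\<exists>N. \<forall>d\<ge>N. poly p (of_nat d) = of_nat (card (exponents b (B \<union> A) d)))"
  using assms(4,5)
proof (induction B rule: finite_induct)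
  case empty
  show ?case
    using card_exponents_free[OF assms(1-3)]
    by (intro exI[of _ "shift_poly (card A - 1)"]) (simp add: degree_shift_poly poly_shift_poly lead_coeff_shift_poly[unfolded degree_shift_poly])
next
  case (insert u B)
  define r where "r = card A - 1"
  have bu: "b u > 0" using insert.prems by simp
  obtain p :: "rat poly" and N where p: "degree p = r" "lead_coeff p = (\<Prod>v\<in>B. of_nat (b v)) / fact r"
      "\<forall>d\<ge>N. poly p (of_nat d) = of_nat (card (exponents b (B \<union> A) d))"
    using insert.IH[OF insert.prems[OF insertI2]] unfolding r_def by blast
  have prod_pos: "(\<Prod>v\<in>B. of_nat (b v)) > (0 :: rat)"
    using insert.prems by (intro prod_pos) auto
  define q where "q = (\<Sum>c<b u. pcompose p [:- of_nat c, 1:])"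
  have "degree (pcompose p [:- of_nat c, 1:]) = r" for c
    by (simp add: degree_pcompose p(1))
  moreover have "poly.coeff (pcompose p [:- of_nat c, 1:]) r = lead_coeff p" for c
    using lead_coeff_comp[of "[:- of_nat c, 1:]" p] calculation[of c] by simp
  ultimately have "degree q \<le> r" and coeff: "poly.coeff q r = of_nat (b u) * lead_coeff p"
    unfolding q_def by (auto intro!: degree_sum_le simp: coeff_sum)
  moreover have "poly.coeff q r \<noteq> 0"
    using bu prod_pos unfolding coeff p(2) by simp
  ultimately have deg: "degree q = r" using le_degree le_antisym by blast
  \<comment> \<open>From \<open>N + b u\<close> on, every \<open>c < b u\<close> is an admissible
    exponent, no difference \<open>d - c\<close> is truncated, and \<open>d - c\<close> still lies
    in the range where \<open>p\<close> counts.\<close>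
  have "poly q (of_nat d) = of_nat (card (exponents b (insert u B \<union> A) d))" if d: "d \<ge> N + b u" for d
  proof -
    have "u \<notin> B \<union> A" using bu assms(3) insert.hyps by auto
    then have "card (exponents b (insert u (B \<union> A)) d) = (\<Sum>c | c \<le> d \<and> (b u > 0 \<longrightarrow> c < b u). card (exponents b (B \<union> A) (d - c)))"
      using assms insert by (intro card_exponents_insert) auto
    also have "{c. c \<le> d \<and> (b u > 0 \<longrightarrow> c < b u)} = {..<b u}" using bu d by auto
    finally have "of_nat (card (exponents b (insert u (B \<union> A)) d)) = (\<Sum>c<b u. of_nat (card (exponents b (B \<union> A) (d - c))) :: rat)"
      by simp
    also have "\<dots> = (\<Sum>c<b u. poly p (of_nat (d - c)))"
    proof (rule sum.cong)
      fix c assume "c \<in> {..<b u}"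
      then have "d - c \<ge> N" using d by simp
      then show "of_nat (card (exponents b (B \<union> A) (d - c))) = poly p (of_nat (d - c))"
        by (rule p(3)[rule_format, symmetric])
    qed simp
    also have "\<dots> = poly q (of_nat d)"
      unfolding q_def poly_sum using d by (intro sum.cong) (auto simp: poly_pcompose of_nat_diff)
    finally show ?thesis by simp
  qed
  moreover have "lead_coeff q = (\<Prod>v\<in>insert u B. of_nat (b v)) / fact r"
    using insert.hyps by (simp add: deg coeff p(2))
  ultimately show ?case using deg unfolding r_def by blast
qed

section \<open>From the count of standard monomials to the degree\<close>

context adapted_basis
begin

text \<open>The Hilbert polynomial has degree one less than the number of free variables, and the
  factorial of this degree cancels the denominator of its leading coefficient. The variable
  \<open>v0\<close> guarantees that there is a free variable.\<close>

lemma proj_degree_eq: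
  fixes Y :: "('v \<Rightarrow> 'k) set set"
  assumes gI: "\<And>v. b v > 0 \<Longrightarrow> g v \<in> proj_ideal Y"
    and red: "\<And>p d. p \<in> proj_ideal Y \<inter> forms d \<Longrightarrow> \<exists>\<mu> Z. dominant W Z \<mu> \<and> (\<forall>v. b v > 0 \<longrightarrow> lookup \<mu> v = 0) \<and>
      Z * p \<in> ideal.span (g ` {v. b v > 0})"
    and free: "b v0 = 0"
  shows "proj_degree Y = (\<Prod>v | b v > 0. of_nat (b v))"
proof -
  let ?A = "{v. b v = 0}" and ?B = "{v. b v > 0}"
  have "?A \<noteq> {}" using free by auto
  then have "\<exists>p :: rat poly. degree p = card ?A - 1 \<and> lead_coeff p = (\<Prod>v\<in>?B. of_nat (b v)) / fact (card ?A - 1) \<and>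
      (\<exists>N. \<forall>d\<ge>N. poly p (of_nat d) = of_nat (card (exponents b (?B \<union> ?A) d)))"
    by (intro card_exponents_poly) simp_all
  then obtain p :: "rat poly" and N where p: "degree p = card ?A - 1"
      "lead_coeff p = (\<Prod>v\<in>?B. of_nat (b v)) / fact (card ?A - 1)"
      "\<forall>d\<ge>N. poly p (of_nat d) = of_nat (card (exponents b (?B \<union> ?A) d))"
    by (elim exE conjE)
  have *: "card {m \<in> monomials d. standard m} = card (exponents b (?B \<union> ?A) d)" for d
  proof (rule bij_betw_same_card[of lookup], rule bij_betw_imageI)
    show "inj_on lookup {m \<in> monomials d. standard m}"
      by (auto intro!: inj_onI poly_mapping_eqI)
    have "?B \<union> ?A = UNIV" by auto
    moreover have "f \<in> range lookup" for f :: "'v \<Rightarrow> nat"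
      by (rule range_eqI[of _ _ "Abs_poly_mapping f"]) simp
    ultimately show "lookup ` {m \<in> monomials d. standard m} = exponents b (?B \<union> ?A) d"
      by (fastforce simp: exponents_def monomials_def monom_degree_altdef standard_def image_iff)
  qed
  have "is_hilbert_polynomial (proj_ideal Y) p"
    unfolding is_hilbert_polynomial_def
  proof (intro exI[of _ N] allI impI)
    fix d assume "d \<ge> N"
    have "hilbert_function (proj_ideal Y) d = int (card {m \<in> monomials d. standard m})"
      by (rule hilbert_function_eq_card_standard)
         (use gI red in \<open>auto simp: proj_ideal_def\<close>)
    then show "poly p (of_nat d) = of_int (hilbert_function (proj_ideal Y) d)"
      using p(3) \<open>d \<ge> N\<close> * by simp
  qed
  then have hp: "hilbert_polynomial (proj_ideal Y) = p"
    unfolding hilbert_polynomial_def by (intro the_equality is_hilbert_polynomial_unique)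
  show ?thesis
    unfolding proj_degree_def Let_def hp p(2) unfolding p(1) by simp
qed

end

section \<open>Linear algebra over commutative rings\<close>

text \<open>The adjugate in the form of Cramer's rule: column \<open>k\<close> of \<open>A\<close>
  is replaced by the \<open>i\<close>-th unit vector. The matrix is written transposed, so that the
  replaced column is a row of the determinant.\<close>

definition left_adjugate :: "'a::comm_ring_1 ^ 'n ^ 'n \<Rightarrow> 'a ^ 'n ^ 'n"
  where "left_adjugate A = (\<chi> k i. det (\<chi> a b. if a = k then (if b = i then 1 else 0) else A $ b $ a))"

text \<open>By linearity in the replaced row, the sum is the determinant of the transpose of
  \<open>A\<close> with row \<open>k\<close> replaced by row \<open>j\<close>. For
  \<open>k \<noteq> j\<close> two rows coincide.\<close>

lemma left_adjugate_mult:
  fixes A :: "'a::comm_ring_1 ^ 'n::finite ^ 'n"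
  shows "(\<Sum>i\<in>UNIV. left_adjugate A $ k $ i * A $ i $ j) = (if k = j then det A else 0)"
proof -
  define B where "B = transpose A"
  have e: "(\<chi> b. if b = i then 1 else 0) = axis i (1 :: 'a)" for i :: 'n
    by (simp add: axis_def)
  have "(\<Sum>i\<in>UNIV. left_adjugate A $ k $ i * A $ i $ j) =
      (\<Sum>i\<in>UNIV. det (\<chi> a. if a = k then B $ j $ i *s axis i 1 else B $ a))"
    unfolding det_row_mul
    by (intro sum.cong refl)
       (auto simp: left_adjugate_def B_def transpose_def mult.commute axis_def vec_eq_iff
         intro!: arg_cong2[of _ _ _ _ "(*)"] arg_cong[of _ _ det])
  also have "\<dots> = det (\<chi> a. if a = k then (\<Sum>i\<in>UNIV. B $ j $ i *s axis i 1) else B $ a)"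
    by (rule det_linear_row_sum[symmetric]) simp
  also have "(\<Sum>i\<in>UNIV. B $ j $ i *s axis i 1) = B $ j"
    by (simp add: basis_expansion)
  also have "det (\<chi> a. if a = k then B $ j else B $ a) = (if k = j then det A else 0)"
  proof (cases "k = j")
    case True
    then have "(\<chi> a. if a = k then B $ j else B $ a) = B" by (auto simp: vec_eq_iff)
    then show ?thesis using True by (simp add: B_def)
  next
    case False
    then show ?thesis by (auto intro!: det_identical_rows[of k j] simp: row_def vec_eq_iff)
  qed
  finally show ?thesis .
qed

lemma (in comm_ring_hom) hom_left_adjugate:
  "h (left_adjugate A $ k $ i) = left_adjugate (\<chi> i j. h (A $ i $ j)) $ k $ i"
  unfolding left_adjugate_def
  by (auto simp: hom_det hom_simps vec_eq_iff intro!: arg_cong[of _ _ det])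

text \<open>The ranks \<open>rk\<close> allow triangularity in any order of the indices. A
  permutation preserves the sum of all ranks, so unless it is the identity it raises some rank, and
  there the product has a zero factor.\<close>

lemma det_triangular:
  fixes A :: "'a::comm_ring_1 ^ 'n::finite ^ 'n" and rk :: "'n \<Rightarrow> nat"
  assumes inj: "inj rk" and zero: "\<And>i j. rk i < rk j \<Longrightarrow> A $ i $ j = 0"
  shows "det A = (\<Prod>i\<in>UNIV. A $ i $ i)"
proof -
  have *: "of_int (sign p) * (\<Prod>i\<in>UNIV. A $ i $ p i) = 0" if p: "p permutes UNIV" "p \<noteq> id" for p
  proof -
    have "\<exists>i. rk i < rk (p i)"
    proof (rule ccontr)
      assume "\<not> ?thesis"
      then have le: "rk (p i) \<le> rk i" for i by (simp add: not_less)
      have "(\<Sum>i\<in>UNIV. rk (p i)) = (\<Sum>i\<in>UNIV. rk i)"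
        by (rule sum.reindex_bij_betw) (use p(1) permutes_bij in blast)
      then have "rk (p i) = rk i" for i
        using sum_mono_inv[of "rk \<circ> p" UNIV rk i] le by simp
      then have "p = id" using inj by (auto simp: inj_def)
      with p show False by simp
    qed
    then obtain i where "A $ i $ p i = 0" using zero by blast
    then have "(\<Prod>i\<in>UNIV. A $ i $ p i) = 0" by (intro prod_zero) auto
    then show ?thesis by simp
  qed
  have "det A = (\<Sum>p\<in>{id}. of_int (sign p) * (\<Prod>i\<in>UNIV. A $ i $ p i))"
    unfolding det_def using * by (intro sum.mono_neutral_right) (auto simp: permutes_id)
  then show ?thesis by (simp add: sign_id)
qed

lemma char_poly_triangular:
  fixes A :: "'a::comm_ring_1 ^ 'n::finite ^ 'n" and rk :: "'n \<Rightarrow> nat"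
  assumes "inj rk" "\<And>i j. rk i < rk j \<Longrightarrow> A $ i $ j = 0"
  shows "char_poly A = (\<Prod>i\<in>UNIV. [:- (A $ i $ i), 1:])"
  unfolding char_poly_def
  by (subst det_triangular[OF assms(1)]) (use assms(2) in \<open>auto simp: mat_def\<close>)

text \<open>The vector \<open>p(A) v\<close> by Horner's rule; vectors become a module over the
  univariate polynomials, with the variable acting as \<open>A\<close>.\<close>

definition poly_act :: "'a::comm_ring_1 ^ 'n ^ 'n \<Rightarrow> 'a poly \<Rightarrow> 'a ^ 'n \<Rightarrow> 'a ^ 'n"
  where "poly_act A p = fold_coeffs (\<lambda>a f v. a *s v + A *v f v) p (\<lambda>_. 0)"

lemma poly_act_0 [simp]: "poly_act A 0 v = 0"
  by (simp add: poly_act_def)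

lemma poly_act_pCons [simp]: "poly_act A (pCons a p) v = a *s v + A *v poly_act A p v"
  by (cases "a = 0 \<and> p = 0") (auto simp: poly_act_def)

lemma matrix_vector_mult_smult:
  fixes A :: "'a::comm_ring_1 ^ 'n ^ 'm"
  shows "A *v (c *s x) = c *s (A *v x)"
  by (simp add: matrix_vector_mult_def vec_eq_iff sum_distrib_left mult_ac)

lemma poly_act_add: "poly_act A (p + q) v = poly_act A p v + poly_act A q v"
  by (induction p q rule: poly_induct2)
     (simp_all add: vector_sadd_rdistrib matrix_vector_right_distrib)

lemma poly_act_smult: "poly_act A (smult c p) v = c *s poly_act A p v"
  by (induction p) (simp_all add: vector_add_ldistrib vector_smult_assoc matrix_vector_mult_smult)

lemma poly_act_diff: "poly_act A (p - q) v = poly_act A p v - poly_act A q v"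
  using poly_act_add[of A "p - q" q v] by simp

lemma poly_act_add_right: "poly_act A p (v + w) = poly_act A p v + poly_act A p w"
  by (induction p) (simp_all add: vector_add_ldistrib matrix_vector_right_distrib)

lemma poly_act_smult_right: "poly_act A p (c *s v) = c *s poly_act A p v"
  by (induction p) (simp_all add: vector_add_ldistrib matrix_vector_mult_smult vector_smult_assoc mult.commute)

lemma poly_act_0_right [simp]: "poly_act A p 0 = 0"
  by (induction p) simp_all

lemma poly_act_sum: "poly_act A (\<Sum>x\<in>S. f x) v = (\<Sum>x\<in>S. poly_act A (f x) v)"
  by (induction S rule: infinite_finite_induct) (simp_all add: poly_act_add)

lemma poly_act_sum_right: "poly_act A p (\<Sum>x\<in>S. f x) = (\<Sum>x\<in>S. poly_act A p (f x))"
  by (induction S rule: infinite_finite_induct) (simp_all add: poly_act_add_right)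

lemma poly_act_mult: "poly_act A (p * q) v = poly_act A p (poly_act A q v)"
  by (induction p) (simp_all add: mult_pCons_left poly_act_add poly_act_smult)

lemma poly_act_1 [simp]: "poly_act A 1 v = v"
  by (simp add: one_pCons)

text \<open>The module-theoretic proof: the polynomial matrix \<open>M\<close>, the transpose of
  \<open>X - A\<close>, annihilates the family of unit vectors, because \<open>A\<close> sends the
  \<open>i\<close>-th one to column \<open>i\<close> of \<open>A\<close>. Multiplying by the
  adjugate of \<open>M\<close> shows that \<open>det M\<close> annihilates each unit vector.\<close>

theorem cayley_hamilton:
  fixes A :: "'a::comm_ring_1 ^ 'n::finite ^ 'n"
  shows "poly_act A (char_poly A) v = 0"
proof -
  let ?e = "\<lambda>i. axis i (1 :: 'a)"
  define M :: "'a poly ^ 'n ^ 'n" where "M = transpose (mat [:0, 1:] - (\<chi> i j. [:A $ i $ j:]))"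
  have det_M: "det M = char_poly A"
    by (simp add: M_def char_poly_def)
  have M: "(\<Sum>j\<in>UNIV. poly_act A (M $ i $ j) (?e j)) = 0" for i
  proof -
    have "(\<Sum>j\<in>UNIV. poly_act A (M $ i $ j) (?e j)) =
        (\<Sum>j\<in>UNIV. (if j = i then A *v ?e i else 0) - A $ j $ i *s ?e j)"
      by (intro sum.cong) (auto simp: M_def transpose_def mat_def poly_act_diff)
    also have "\<dots> = A *v ?e i - (\<Sum>j\<in>UNIV. A $ j $ i *s ?e j)"
      by (simp add: sum_subtractf)
    also have "A *v ?e i = (\<Sum>j\<in>UNIV. A $ j $ i *s ?e j)"
      by (simp add: vec_eq_iff matrix_vector_mult_def axis_def if_distrib cong: if_cong)
    finally show ?thesis by simp
  qed
  have e: "poly_act A (char_poly A) (?e k) = 0" for k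
  proof -
    have "poly_act A (char_poly A) (?e k) = (\<Sum>j\<in>UNIV. if k = j then poly_act A (det M) (?e j) else 0)"
      by (simp add: det_M)
    also have "\<dots> = (\<Sum>j\<in>UNIV. poly_act A (\<Sum>i\<in>UNIV. left_adjugate M $ k $ i * M $ i $ j) (?e j))"
      unfolding left_adjugate_mult by (intro sum.cong) auto
    also have "\<dots> = (\<Sum>j\<in>UNIV. \<Sum>i\<in>UNIV. poly_act A (left_adjugate M $ k $ i) (poly_act A (M $ i $ j) (?e j)))"
      by (simp add: poly_act_sum poly_act_mult)
    also have "\<dots> = (\<Sum>i\<in>UNIV. poly_act A (left_adjugate M $ k $ i) (\<Sum>j\<in>UNIV. poly_act A (M $ i $ j) (?e j)))"
      by (subst sum.swap) (simp add: poly_act_sum_right)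
    also have "\<dots> = 0" by (simp add: M)
    finally show ?thesis .
  qed
  have "poly_act A (char_poly A) (\<Sum>i\<in>UNIV. v $ i *s ?e i) = 0"
    by (simp add: poly_act_sum_right poly_act_smult_right e)
  then show ?thesis by (simp add: basis_expansion)
qed

section \<open>Newton bases of Krylov spaces\<close>

primrec krylov :: "'a::comm_ring_1 ^ 'n ^ 'n \<Rightarrow> (nat \<Rightarrow> 'a) \<Rightarrow> 'a ^ 'n \<Rightarrow> nat \<Rightarrow> 'a ^ 'n"
  where
    "krylov A c e 0 = e"
  | "krylov A c e (Suc k) = A *v krylov A c e k - c k *s krylov A c e k"

lemma krylov_eq_poly_act: "krylov A c e k = poly_act A (\<Prod>i<k. [:- c i, 1:]) e"
proof (induction k)
  case (Suc k)
  have "poly_act A (\<Prod>i<Suc k. [:- c i, 1:]) e = poly_act A ([:- c k, 1:] * (\<Prod>i<k. [:- c i, 1:])) e"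
    by (simp only: prod.lessThan_Suc mult.commute)
  also have "\<dots> = krylov A c e (Suc k)"
    unfolding poly_act_mult Suc[symmetric] by (simp add: vector_sneg_minus1 vector_smult_assoc)
  finally show ?case by simp
qed simp

lemma (in comm_ring_hom) hom_krylov:
  "h (krylov A c e k $ i) = krylov (\<chi> i j. h (A $ i $ j)) (\<lambda>i. h (c i)) (\<chi> i. h (e $ i)) k $ i"
  by (induction k arbitrary: i) (simp_all add: matrix_vector_mult_def hom_simps)

text \<open>The index type carries no order; \<open>idx\<close> fixes one, which gives a meaning to
  first and last index, subdiagonal and triangular.\<close>

locale coordinate_order =
  fixes idx :: "'n::finite \<Rightarrow> nat"
  assumes bij_idx: "bij_betw idx UNIV {..<CARD('n)}"
begin

definition nth_index :: "nat \<Rightarrow> 'n"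
  where "nth_index k = inv_into UNIV idx k"

lemma idx_nth_index: "k < CARD('n) \<Longrightarrow> idx (nth_index k) = k"
  unfolding nth_index_def using bij_betw_inv_into_right[OF bij_idx] by auto

lemma nth_index_idx [simp]: "nth_index (idx i) = i"
  unfolding nth_index_def using bij_betw_inv_into_left[OF bij_idx] by auto

lemma idx_less: "idx i < CARD('n)"
  using bij_idx by (auto simp: bij_betw_def)

lemma inj_idx: "inj idx"
  using bij_idx by (auto simp: bij_betw_def)

lemma idx_eq_iff [simp]: "idx i = idx j \<longleftrightarrow> i = j"
  using inj_idx by (auto simp: inj_def)

lemma prod_idx: "(\<Prod>i\<in>UNIV. f (idx i)) = (\<Prod>k<CARD('n). f k)"
  by (rule prod.reindex_bij_betw[OF bij_idx])

definition krylov_matrix :: "'a::comm_ring_1 ^ 'n ^ 'n \<Rightarrow> (nat \<Rightarrow> 'a) \<Rightarrow> 'a ^ 'n ^ 'n"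
  where "krylov_matrix A c = (\<chi> i j. krylov A c (axis (nth_index 0) 1) (idx j) $ i)"

definition krylov_det :: "'a::comm_ring_1 ^ 'n ^ 'n \<Rightarrow> (nat \<Rightarrow> 'a) \<Rightarrow> 'a"
  where "krylov_det A c = det (krylov_matrix A c)"

text \<open>The vector that follows the last column of \<open>krylov_matrix\<close>. By
  Cayley-Hamilton it is zero whenever the characteristic polynomial of \<open>A\<close> is the
  product of the \<open>X - c k\<close>.\<close>

definition krylov_end :: "'a::comm_ring_1 ^ 'n ^ 'n \<Rightarrow> (nat \<Rightarrow> 'a) \<Rightarrow> 'a ^ 'n"
  where "krylov_end A c = krylov A c (axis (nth_index 0) 1) (CARD('n))"

text \<open>
  Modifying \<open>A\<close> by a matrix of rank one that kills all but the last vector of the Newton basis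
  makes it act on this basis by a triangular matrix with diagonal \<open>c\<close>.  The factor
  \<open>krylov_det A c\<close> clears the denominators.
\<close>

definition deform :: "'a::comm_ring_1 ^ 'n ^ 'n \<Rightarrow> (nat \<Rightarrow> 'a) \<Rightarrow> 'a ^ 'n ^ 'n"
  where "deform A c = (\<chi> i j. krylov_det A c * A $ i $ j -
    krylov_end A c $ i * left_adjugate (krylov_matrix A c) $ nth_index (CARD('n) - 1) $ j)"

lemma hom_krylov_matrix:
  assumes "comm_ring_hom h"
  shows "h (krylov_matrix A c $ i $ j) = krylov_matrix (\<chi> i j. h (A $ i $ j)) (\<lambda>i. h (c i)) $ i $ j"
proof -
  interpret comm_ring_hom h by fact
  have "(\<chi> i. h (axis k 1 $ i)) = axis k 1" for k :: 'n
    by (simp add: vec_eq_iff axis_def hom_simps)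
  then show ?thesis by (simp add: krylov_matrix_def hom_krylov)
qed

lemma hom_krylov_end:
  assumes "comm_ring_hom h"
  shows "h (krylov_end A c $ i) = krylov_end (\<chi> i j. h (A $ i $ j)) (\<lambda>i. h (c i)) $ i"
proof -
  interpret comm_ring_hom h by fact
  have "(\<chi> i. h (axis k 1 $ i)) = axis k 1" for k :: 'n
    by (simp add: vec_eq_iff axis_def hom_simps)
  then show ?thesis by (simp add: krylov_end_def hom_krylov)
qed

lemma hom_krylov_det:
  assumes "comm_ring_hom h"
  shows "h (krylov_det A c) = krylov_det (\<chi> i j. h (A $ i $ j)) (\<lambda>i. h (c i))"
  unfolding krylov_det_def comm_ring_hom.hom_det[OF assms]
  by (simp add: hom_krylov_matrix[OF assms])

lemma hom_deform:
  assumes "comm_ring_hom h"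
  shows "h (deform A c $ i $ j) = deform (\<chi> i j. h (A $ i $ j)) (\<lambda>i. h (c i)) $ i $ j"
proof -
  interpret comm_ring_hom h by fact
  have m: "(\<chi> i j. h (krylov_matrix A c $ i $ j)) = krylov_matrix (\<chi> i j. h (A $ i $ j)) (\<lambda>i. h (c i))"
    using hom_krylov_matrix[OF assms] by (simp add: vec_eq_iff)
  show ?thesis
    unfolding deform_def
    by (simp add: hom_simps hom_krylov_det[OF assms] hom_krylov_end[OF assms] hom_left_adjugate m)
qed

text \<open>Write \<open>v k\<close> for the Newton basis. \<open>A\<close> maps \<open>v k\<close>
  to \<open>c k\<close> times itself plus \<open>v (k + 1)\<close>. On the last column the rank one
  correction subtracts exactly the overflowing term \<open>krylov_end\<close>, so the bidiagonal
  matrix \<open>C\<close> describes the action on all columns.\<close>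

lemma deform_mult_krylov_matrix:
  fixes A :: "'a::comm_ring_1 ^ 'n ^ 'n" and c :: "nat \<Rightarrow> 'a"
  defines "C \<equiv> (\<chi> i j. if i = j then c (idx i) else if idx i = Suc (idx j) then 1 else 0) :: 'a ^ 'n ^ 'n"
  shows "(deform A c ** krylov_matrix A c) $ i $ k = krylov_det A c * (krylov_matrix A c ** C) $ i $ k"
proof -
  let ?n = "CARD('n)" and ?D = "krylov_det A c" and ?G = "krylov_matrix A c"
  let ?v = "krylov A c (axis (nth_index 0) 1)" and ?l = "nth_index (CARD('n) - 1)"
  have n: "?n > 0" by simp
  have "(deform A c ** ?G) $ i $ k = ?D * (A *v ?v (idx k)) $ i - ?v ?n $ i * (\<Sum>j\<in>UNIV. left_adjugate ?G $ ?l $ j * ?G $ j $ k)"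
    by (simp add: deform_def matrix_matrix_mult_def krylov_matrix_def krylov_end_def matrix_vector_mult_def
        sum_subtractf sum_distrib_left algebra_simps)
  also have "\<dots> = ?D * ((A *v ?v (idx k)) $ i - (if ?l = k then ?v ?n $ i else 0))"
    unfolding left_adjugate_mult by (simp add: krylov_det_def algebra_simps)
  also have "(A *v ?v (idx k)) $ i - (if ?l = k then ?v ?n $ i else 0) =
      c (idx k) * ?v (idx k) $ i + (if idx k < ?n - 1 then ?v (Suc (idx k)) $ i else 0)"
  proof (cases "?l = k")
    case True
    then have "idx k = ?n - 1" using idx_nth_index[of "?n - 1"] n by auto
    then have "Suc (idx k) = ?n" using n by simp
    then have "?v ?n = A *v ?v (idx k) - c (idx k) *s ?v (idx k)" by (metis krylov.simps(2))
    then show ?thesis using True \<open>Suc (idx k) = ?n\<close> by simp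
  next
    case False
    then have "idx k \<noteq> ?n - 1" using nth_index_idx[of k] by metis
    then have "idx k < ?n - 1" using idx_less[of k] by simp
    then show ?thesis using False by simp
  qed
  also have "\<dots> = (?G ** C) $ i $ k"
  proof -
    have "(?G ** C) $ i $ k = (\<Sum>j\<in>UNIV. (if j = k then c (idx k) * ?v (idx k) $ i else 0) +
        (if idx j = Suc (idx k) then ?v (Suc (idx k)) $ i else 0))"
      unfolding matrix_matrix_mult_def C_def
      by (auto simp: krylov_matrix_def intro!: sum.cong)
    also have "\<dots> = c (idx k) * ?v (idx k) $ i + (\<Sum>j\<in>UNIV. if idx j = Suc (idx k) then ?v (Suc (idx k)) $ i else 0)"
      by (simp add: sum.distrib)
    also have "(\<Sum>j\<in>UNIV. if idx j = Suc (idx k) then ?v (Suc (idx k)) $ i else 0) =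
        (if idx k < ?n - 1 then ?v (Suc (idx k)) $ i else 0)"
    proof (cases "idx k < ?n - 1")
      case True
      then have "idx j = Suc (idx k) \<longleftrightarrow> j = nth_index (Suc (idx k))" for j
        using idx_nth_index[of "Suc (idx k)"] idx_eq_iff[of j "nth_index (Suc (idx k))"] True by simp
      then show ?thesis using True by simp
    next
      case False
      then have "idx j \<noteq> Suc (idx k)" for j
        using idx_less[of j] by simp
      then show ?thesis using False by simp
    qed
    finally show ?thesis ..
  qed
  finally show ?thesis .
qed

text \<open>A similarity argument without inverses: \<open>krylov_matrix\<close> intertwines the
  deformed matrix with the triangular matrix \<open>krylov_det A c * C\<close>. Determinants of the
  characteristic matrices then agree up to the factor \<open>krylov_det A c\<close>, which cannot be
  cancelled in a general ring.\<close>

lemma char_poly_deform: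
  fixes A :: "'a::comm_ring_1 ^ 'n ^ 'n"
  shows "smult (krylov_det A c) (char_poly (deform A c)) =
    smult (krylov_det A c) (\<Prod>k<CARD('n). [:- (krylov_det A c * c k), 1:])"
proof -
  let ?D = "krylov_det A c" and ?G = "krylov_matrix A c"
  define C :: "'a ^ 'n ^ 'n" where "C = (\<chi> i j. if i = j then c (idx i) else if idx i = Suc (idx j) then 1 else 0)"
  have "comm_ring_hom (\<lambda>a :: 'a. [:a:])" by standard (simp_all add: one_pCons mult.commute)
  then interpret h: comm_ring_hom "\<lambda>a :: 'a. [:a:]" .
  define L :: "'a ^ 'n ^ 'n \<Rightarrow> 'a poly ^ 'n ^ 'n" where "L B = (\<chi> i j. [:B $ i $ j:])" for B
  have det_L: "det (L B) = [:det B:]" for B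
    using h.hom_det[of B] by (simp add: L_def)
  have L_mult: "L (B ** B') = L B ** L B'" for B B'
    by (simp add: L_def vec_eq_iff matrix_matrix_mult_def h.hom_simps del: mult_pCons_left mult_pCons_right)
  have "deform A c ** ?G = ?G ** (\<chi> i j. ?D * C $ i $ j)"
    unfolding vec_eq_iff deform_mult_krylov_matrix C_def[symmetric]
    by (simp add: matrix_matrix_mult_def sum_distrib_left mult_ac)
  then have "(mat [:0, 1:] - L (deform A c)) ** L ?G = L ?G ** (mat [:0, 1:] - L (\<chi> i j. ?D * C $ i $ j))"
  proof -
    assume *: "deform A c ** ?G = ?G ** (\<chi> i j. ?D * C $ i $ j)"
    have X: "mat [:0, 1:] ** B = B ** mat [:0, 1:]" for B :: "'a poly ^ 'n ^ 'n"
      by (simp add: vec_eq_iff matrix_matrix_mult_def mat_def if_distrib if_distribR mult.commute cong: if_cong)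
    have d1: "(B - B') ** B'' = B ** B'' - B' ** B''" for B B' B'' :: "'a poly ^ 'n ^ 'n"
      by (simp add: vec_eq_iff matrix_matrix_mult_def left_diff_distrib sum_subtractf)
    have d2: "B'' ** (B - B') = B'' ** B - B'' ** B'" for B B' B'' :: "'a poly ^ 'n ^ 'n"
      by (simp add: vec_eq_iff matrix_matrix_mult_def right_diff_distrib sum_subtractf)
    show ?thesis unfolding d1 d2 X L_mult[symmetric] * ..
  qed
  then have "det (mat [:0, 1:] - L (deform A c)) * det (L ?G) = det (L ?G) * det (mat [:0, 1:] - L (\<chi> i j. ?D * C $ i $ j))"
    by (metis det_mul)
  then have "smult ?D (det (mat [:0, 1:] - L (deform A c))) = smult ?D (det (mat [:0, 1:] - L (\<chi> i j. ?D * C $ i $ j)))"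
    unfolding det_L krylov_det_def by simp
  then have "smult ?D (char_poly (deform A c)) = smult ?D (char_poly (\<chi> i j. ?D * C $ i $ j))"
    unfolding char_poly_def L_def .
  also have "char_poly (\<chi> i j. ?D * C $ i $ j) = (\<Prod>i\<in>UNIV. [:- (?D * c (idx i)), 1:])"
    by (subst char_poly_triangular[OF inj_idx]) (auto simp: C_def)
  also have "\<dots> = (\<Prod>k<CARD('n). [:- (?D * c k), 1:])" by (rule prod_idx)
  finally show ?thesis .
qed

end

section \<open>Homogeneity of the coefficients of the characteristic polynomial\<close>

text \<open>Joint homogeneity of degree \<open>d\<close>, with the univariate variable counted in
  degree 1. Since \<open>d - j\<close> truncates to 0 for \<open>j > d\<close>, the vanishing of
  these coefficients is demanded separately.\<close>

definition homogeneous_poly :: "nat \<Rightarrow> ('v, 'k::comm_ring_1) mpoly poly \<Rightarrow> bool"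
  where "homogeneous_poly d q \<longleftrightarrow> (\<forall>j. poly.coeff q j \<in> forms (d - j) \<and> (j > d \<longrightarrow> poly.coeff q j = 0))"

lemma homogeneous_poly_mult:
  fixes p q :: "('v::finite, 'k::comm_ring_1) mpoly poly"
  assumes "homogeneous_poly d p" "homogeneous_poly e q"
  shows "homogeneous_poly (d + e) (p * q)"
  unfolding homogeneous_poly_def
proof (intro allI conjI impI)
  fix j
  show "poly.coeff (p * q) j \<in> forms (d + e - j)"
    unfolding coeff_mult
  proof (rule forms_sum)
    fix i assume i: "i \<in> {..j}"
    show "poly.coeff p i * poly.coeff q (j - i) \<in> forms (d + e - j)"
    proof (cases "i \<le> d \<and> j - i \<le> e")
      case True
      then have "d + e - j = (d - i) + (e - (j - i))" using i by auto
      then show ?thesis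
        using assms unfolding homogeneous_poly_def by (simp only:) (blast intro: forms_mult)
    next
      case False
      then show ?thesis using assms by (auto simp: homogeneous_poly_def not_le)
    qed
  qed
  assume j: "j > d + e"
  have "poly.coeff p i * poly.coeff q (j - i) = 0" if "i \<le> j" for i
  proof (cases "i > d")
    case False
    then have "j - i > e" using j that by simp
    then show ?thesis using assms by (simp add: homogeneous_poly_def)
  qed (use assms in \<open>simp add: homogeneous_poly_def\<close>)
  then show "poly.coeff (p * q) j = 0" by (simp add: coeff_mult)
qed

lemma homogeneous_poly_uminus: "homogeneous_poly d p \<Longrightarrow> homogeneous_poly d (- p)"
  by (simp add: homogeneous_poly_def forms_uminus)

lemma homogeneous_poly_sum: "(\<And>x. x \<in> A \<Longrightarrow> homogeneous_poly d (f x)) \<Longrightarrow> homogeneous_poly d (sum f A)"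
  by (simp add: homogeneous_poly_def coeff_sum forms_sum)

lemma homogeneous_poly_prod:
  fixes f :: "'a \<Rightarrow> ('v::finite, 'k::comm_ring_1) mpoly poly"
  assumes "\<And>x. x \<in> A \<Longrightarrow> homogeneous_poly (e x) (f x)"
  shows "homogeneous_poly (sum e A) (prod f A)"
proof -
  have "homogeneous_poly 0 (1 :: ('v, 'k) mpoly poly)"
    by (simp add: homogeneous_poly_def forms_1)
  then show ?thesis using assms
    by (induction A rule: infinite_finite_induct) (auto intro: homogeneous_poly_mult)
qed

lemma of_int_sign_mult: "of_int (sign p) * x = x \<or> of_int (sign p) * x = - (x :: 'a::ring_1)"
  by (auto simp: sign_def)

lemma homogeneous_char_poly:
  fixes A :: "('v::finite, 'k::comm_ring_1) mpoly ^ 'n::finite ^ 'n"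
  assumes "\<And>i j. A $ i $ j \<in> forms 1"
  shows "homogeneous_poly CARD('n) (char_poly A)"
  unfolding char_poly_def det_def
proof (rule homogeneous_poly_sum)
  fix p
  have "homogeneous_poly 1 ((mat [:0, 1:] - (\<chi> i j. [:A $ i $ j:])) $ i $ k)" for i k
    using assms[of i k]
    by (auto simp: homogeneous_poly_def mat_def coeff_pCons forms_1 forms_uminus split: nat.split)
  then have "homogeneous_poly (\<Sum>i\<in>(UNIV :: 'n set). 1) (\<Prod>i\<in>UNIV. (mat [:0, 1:] - (\<chi> i j. [:A $ i $ j:])) $ i $ p i)"
    by (intro homogeneous_poly_prod)
  then show "homogeneous_poly CARD('n) (of_int (sign p) * (\<Prod>i\<in>UNIV. (mat [:0, 1:] - (\<chi> i j. [:A $ i $ j:])) $ i $ p i))"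
    using of_int_sign_mult[of p "\<Prod>i\<in>UNIV. (mat [:0, 1:] - (\<chi> i j. [:A $ i $ j:])) $ i $ p i"]
    by (auto intro: homogeneous_poly_uminus)
qed

lemma generic_matrix_form: "generic_matrix $ i $ j \<in> forms 1"
  unfolding generic_matrix_def vec_lambda_beta by (rule forms_Var)

lemma a_coeff_generic_form:
  assumes "k \<le> CARD('n)"
  shows "a_coeff k (generic_matrix :: ('n::finite coord, 'k::field) mpoly ^ 'n ^ 'n) \<in> forms k"
  using homogeneous_char_poly[of "generic_matrix :: ('n coord, 'k) mpoly ^ 'n ^ 'n", OF generic_matrix_form] assms
  unfolding homogeneous_poly_def a_coeff_def by (metis diff_diff_cancel)

lemma coeff_char_poly_generic_greater:
  assumes "j > CARD('n)"
  shows "poly.coeff (char_poly (generic_matrix :: ('n::finite coord, 'k::field) mpoly ^ 'n ^ 'n)) j = 0"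
  using homogeneous_char_poly[of "generic_matrix :: ('n coord, 'k) mpoly ^ 'n ^ 'n", OF generic_matrix_form] assms
  unfolding homogeneous_poly_def by blast

text \<open>A form of degree 0 is constant, so it can be computed at the zero matrix, whose
  characteristic polynomial is a power of the variable.\<close>

lemma a_coeff_generic_0: "a_coeff 0 (generic_matrix :: ('n::finite coord, 'k::field) mpoly ^ 'n ^ 'n) = 1"
proof -
  let ?G = "generic_matrix :: ('n coord, 'k) mpoly ^ 'n ^ 'n"
  interpret e: comm_ring_hom "eval_mpoly (\<lambda>_ :: 'n coord. 0 :: 'k)" by (rule comm_ring_hom_eval_mpoly)
  obtain rk :: "'n \<Rightarrow> nat" where rk: "inj rk"
    using finite_imp_inj_to_nat_seg[of "UNIV :: 'n set"] by auto
  have "eval_mpoly (\<lambda>_. 0) (a_coeff 0 ?G) = a_coeff 0 (0 :: 'k ^ 'n ^ 'n)"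
    by (simp add: e.hom_a_coeff generic_matrix_def zero_vec_def)
  also have "\<dots> = 1"
    unfolding a_coeff_def by (subst char_poly_triangular[OF rk]) (simp_all flip: monom_altdef[of 1, simplified])
  finally show ?thesis
    using forms_0_eq_Const[OF a_coeff_generic_form[of 0]] by (metis Const_def le0 single_one)
qed

section \<open>Elementary and complete symmetric polynomials\<close>

notation fps_nth (infixl \<open>$$\<close> 75)

text \<open>The generating function of the elementary symmetric polynomials with alternating signs.
  With these signs its coefficients are those of the product of the \<open>T - x i\<close>, read
  from the top.\<close>

definition elem_fps :: "('i \<Rightarrow> 'a::comm_ring_1) \<Rightarrow> 'i set \<Rightarrow> 'a fps"
  where "elem_fps x S = (\<Prod>i\<in>S. 1 - fps_const (x i) * fps_X)"

text \<open>The generating function of the complete homogeneous symmetric polynomials.\<close>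

definition complete_fps :: "('i \<Rightarrow> 'a::comm_ring_1) \<Rightarrow> 'i set \<Rightarrow> 'a fps"
  where "complete_fps x S = (\<Prod>i\<in>S. Abs_fps (\<lambda>m. x i ^ m))"

lemma elem_mult_complete: "elem_fps x S * complete_fps x S = 1"
proof -
  have "(1 - fps_const c * fps_X) * Abs_fps (\<lambda>m. c ^ m) = 1" for c :: 'a
  proof (rule fps_ext)
    fix n show "((1 - fps_const c * fps_X) * Abs_fps (\<lambda>m. c ^ m)) $$ n = 1 $$ n"
      by (cases n) (simp_all add: left_diff_distrib mult.assoc)
  qed
  then show ?thesis
    by (simp add: elem_fps_def complete_fps_def flip: prod.distrib)
qed

lemma elem_fps_nth_Suc:
  assumes "finite S" "u \<notin> S"
  shows "elem_fps x (insert u S) $$ Suc k = elem_fps x S $$ Suc k - x u * elem_fps x S $$ k"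
  using assms by (simp add: elem_fps_def left_diff_distrib mult.assoc)

lemma elem_fps_nth_0: "elem_fps x S $$ 0 = 1"
  by (induction S rule: infinite_finite_induct) (auto simp: elem_fps_def)

lemma elem_fps_nth_greater: "finite S \<Longrightarrow> k > card S \<Longrightarrow> elem_fps x S $$ k = 0"
proof (induction S arbitrary: k rule: finite_induct)
  case empty
  then show ?case by (simp add: elem_fps_def)
next
  case (insert u S)
  then show ?case by (cases k) (auto simp: elem_fps_nth_Suc)
qed

lemma coeff_prod_linear:
  fixes x :: "'i \<Rightarrow> 'a::comm_ring_1"
  assumes "finite S" "k \<le> card S"
  shows "poly.coeff (\<Prod>i\<in>S. [:- x i, 1:]) (card S - k) = elem_fps x S $$ k"
  using assms
proof (induction S arbitrary: k rule: finite_induct)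
  case (insert u S)
  have c: "poly.coeff (\<Prod>i\<in>insert u S. [:- x i, 1:]) j =
      (case j of 0 \<Rightarrow> 0 | Suc j \<Rightarrow> poly.coeff (\<Prod>i\<in>S. [:- x i, 1:]) j) - x u * poly.coeff (\<Prod>i\<in>S. [:- x i, 1:]) j" for j
    using insert.hyps by (simp add: coeff_pCons)
  \<comment> \<open>For \<open>k = 0\<close> the recursion asks for the coefficient one past the
    degree.\<close>
  have deg: "poly.coeff (\<Prod>i\<in>S. [:- x i, 1:]) (Suc (card S)) = 0"
  proof (rule coeff_eq_0)
    have "degree (\<Prod>i\<in>S. [:- x i, 1:]) \<le> (\<Sum>i\<in>S. degree [:- x i, 1:])"
      using degree_prod_sum_le[of S "\<lambda>i. [:- x i, 1:]"] insert.hyps by (simp add: comp_def)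
    also have "\<dots> \<le> (\<Sum>i\<in>S. 1)" by (intro sum_mono) (simp add: degree_pCons_le)
    finally show "degree (\<Prod>i\<in>S. [:- x i, 1:]) < Suc (card S)" by simp
  qed
  show ?case
  proof (cases k)
    case 0
    then show ?thesis using insert.IH[of 0] insert.hyps deg by (simp add: c elem_fps_nth_0)
  next
    case (Suc k')
    show ?thesis
    proof (cases "k' = card S")
      case True
      then show ?thesis
        using insert.hyps insert.IH[of k'] Suc by (simp add: c elem_fps_nth_Suc elem_fps_nth_greater)
    next
      case False
      then have "card S - k' = Suc (card S - k)" "k \<le> card S" "k' \<le> card S" using insert Suc by auto
      then show ?thesis
        using insert.hyps insert.IH[of k'] insert.IH[of k] Suc by (simp add: c elem_fps_nth_Suc)
    qed
  qed
qed (simp add: elem_fps_def)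

lemma elem_fps_scale: "finite S \<Longrightarrow> elem_fps (\<lambda>i. a * x i) S $$ k = a ^ k * elem_fps x S $$ k"
proof (induction S arbitrary: k rule: finite_induct)
  case empty
  then show ?case by (cases k) (simp_all add: elem_fps_def)
next
  case (insert u S)
  then show ?case
    by (cases k) (simp_all add: elem_fps_nth_0 elem_fps_nth_Suc right_diff_distrib mult_ac)
qed

lemma (in comm_ring_hom) hom_elem_fps:
  "finite S \<Longrightarrow> h (elem_fps x S $$ k) = elem_fps (\<lambda>i. h (x i)) S $$ k"
proof (induction S arbitrary: k rule: finite_induct)
  case empty
  then show ?case by (cases k) (simp_all add: elem_fps_def hom_simps)
next
  case (insert u S)
  then show ?case
    by (cases k) (simp_all add: elem_fps_nth_0 elem_fps_nth_Suc hom_simps)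
qed

lemma complete_fps_insert:
  assumes "finite S" "u \<notin> S"
  shows "complete_fps x (insert u S) $$ m = (\<Sum>a=0..m. x u ^ a * complete_fps x S $$ (m - a))"
  using assms by (simp add: complete_fps_def fps_mult_nth)

lemma (in comm_ring_hom) hom_complete_fps:
  "finite S \<Longrightarrow> h (complete_fps x S $$ m) = complete_fps (\<lambda>i. h (x i)) S $$ m"
proof (induction S arbitrary: m rule: finite_induct)
  case empty
  then show ?case by (simp add: complete_fps_def hom_simps)
qed (simp add: complete_fps_insert hom_simps)

lemma complete_fps_form:
  fixes x :: "'i \<Rightarrow> ('v::finite, 'k::comm_ring_1) mpoly"
  assumes "finite S" "\<And>i. i \<in> S \<Longrightarrow> x i \<in> forms 1"
  shows "complete_fps x S $$ m \<in> forms m"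
  using assms
proof (induction S arbitrary: m rule: finite_induct)
  case empty
  then show ?case by (cases m) (auto simp: complete_fps_def forms_1)
next
  case (insert u S)
  have "x u ^ a * complete_fps x S $$ (m - a) \<in> forms m" if "a \<le> m" for a
    using forms_mult[OF forms_power[of "x u" 1 a] insert.IH[of "m - a"]] insert.prems that by simp
  then show ?case by (auto simp: complete_fps_insert[OF insert.hyps] intro!: forms_sum)
qed

lemma complete_fps_nth_0: "complete_fps x S $$ 0 = 1"
  by (induction S rule: infinite_finite_induct) (auto simp: complete_fps_def)

lemma keys_Var_power: "keys (Var v ^ a :: ('v::finite, 'k::comm_ring_1) mpoly) \<subseteq> {Poly_Mapping.single v a}"
  by (simp add: Var_power)

lemma weight_complete_fps:
  fixes W :: "'v::finite \<Rightarrow> nat" and y :: "'i \<Rightarrow> 'v"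
  assumes "finite S" "\<And>i. i \<in> S \<Longrightarrow> W (y i) \<le> w"
    and "k \<in> keys (complete_fps (\<lambda>i. Var (y i) :: ('v, 'k::comm_ring_1) mpoly) S $$ m)"
  shows "weight W k \<le> w * m"
  using assms
proof (induction S arbitrary: m k rule: finite_induct)
  case empty
  then show ?case by (cases m) (auto simp: complete_fps_def)
next
  case (insert u S)
  from insert.prems(2) obtain a where a: "a \<le> m"
      "k \<in> keys ((Var (y u) :: ('v, 'k) mpoly) ^ a * complete_fps (\<lambda>i. Var (y i)) S $$ (m - a))"
    unfolding complete_fps_insert[OF insert.hyps] using keys_sum by fastforce
  then obtain k' where k': "k = Poly_Mapping.single (y u) a + k'"
      "k' \<in> keys (complete_fps (\<lambda>i. Var (y i) :: ('v, 'k) mpoly) S $$ (m - a))"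
    using keys_mult[of "(Var (y u) :: ('v, 'k) mpoly) ^ a"] keys_Var_power[of "y u" a, where ?'k = 'k] by blast
  have "weight W k = W (y u) * a + weight W k'" by (simp add: k' weight_add)
  also have "\<dots> \<le> w * a + w * (m - a)"
    using insert.IH[OF _ k'(2)] insert.prems(1) by (intro add_mono mult_right_mono) auto
  also have "\<dots> = w * m" using a(1) by (simp flip: distrib_left)
  finally show ?case .
qed

text \<open>The power of the heaviest variable \<open>y u\<close> occurs with coefficient 1, and
  every other monomial of the same degree contains a strictly lighter variable.\<close>

lemma dominant_complete_fps:
  fixes W :: "'v::finite \<Rightarrow> nat" and y :: "'i \<Rightarrow> 'v"
  assumes "finite S" "u \<notin> S" "\<And>i. i \<in> S \<Longrightarrow> W (y i) < W (y u)"
  shows "dominant W (complete_fps (\<lambda>i. Var (y i) :: ('v, 'k::comm_ring_1) mpoly) (insert u S) $$ m)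
    (Poly_Mapping.single (y u) m)"
  unfolding dominant_def
proof
  let ?x = "\<lambda>i. Var (y i) :: ('v, 'k) mpoly"
  fix k assume k: "k \<in> keys (complete_fps ?x (insert u S) $$ m - Poly_Mapping.single (Poly_Mapping.single (y u) m) 1)"
  have "complete_fps ?x (insert u S) $$ m = (\<Sum>a=0..<m. ?x u ^ a * complete_fps ?x S $$ (m - a)) + ?x u ^ m"
    by (simp add: complete_fps_insert[OF assms(1,2)] complete_fps_nth_0
        sum.last_plus[of 0 m] atLeastLessThanSuc_atLeastAtMost[symmetric])
  then have "k \<in> keys (\<Sum>a=0..<m. ?x u ^ a * complete_fps ?x S $$ (m - a))"
    using k by (simp add: Var_power)
  then have "k \<in> (\<Union>a\<in>{0..<m}. keys (?x u ^ a * complete_fps ?x S $$ (m - a)))"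
    using keys_sum by (rule rev_subsetD)
  then obtain a where a: "a < m" "k \<in> keys (?x u ^ a * complete_fps ?x S $$ (m - a))"
    by auto
  then obtain k' where k': "k = Poly_Mapping.single (y u) a + k'" "k' \<in> keys (complete_fps ?x S $$ (m - a))"
    using keys_mult[of "?x u ^ a"] keys_Var_power[of "y u" a, where ?'k = 'k] by blast
  show "weight W k < weight W (Poly_Mapping.single (y u) m)"
  proof (cases "W (y u) = 0")
    \<comment> \<open>No weight lies below 0, so \<open>S\<close> is empty and its series is 1,
      without coefficients of positive degree.\<close>
    case True
    then have "S = {}" using assms(3) by auto
    then show ?thesis using k'(2) a(1) by (simp add: complete_fps_def)
  next
    case False
    \<comment> \<open>Weights are integers, so those on \<open>S\<close> are at most
      \<open>W (y u) - 1\<close>; since \<open>m - a\<close> is positive, this gives a strict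
      inequality.\<close>
    have "weight W k' \<le> (W (y u) - 1) * (m - a)"
      using assms(3) by (intro weight_complete_fps[OF assms(1) _ k'(2)]) fastforce
    also have "\<dots> < W (y u) * (m - a)" using False a(1) by simp
    finally have "weight W k < W (y u) * a + W (y u) * (m - a)" by (simp add: k'(1) weight_add)
    also have "\<dots> = W (y u) * m" using a(1) by (simp flip: distrib_left)
    finally show ?thesis by simp
  qed
qed

section \<open>The vanishing ideal\<close>

lemma subst_mpoly_cong_ideal:
  fixes J :: "('w::finite, 'k::comm_ring_1) mpoly set" and y y' :: "'v::finite \<Rightarrow> ('w, 'k) mpoly"
  assumes J: "ideal.subspace J" and y: "\<And>v. y v - y' v \<in> J"
  shows "subst_mpoly y p - subst_mpoly y' p \<in> J"
proof -
  have mult: "a * b - a' * b' \<in> J" if "a - a' \<in> J" "b - b' \<in> J" for a b a' b'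
  proof -
    have "a * b - a' * b' = a * (b - b') + b' * (a - a')" by (simp add: algebra_simps)
    then show ?thesis using that J by (simp add: ideal.subspace_add ideal.subspace_scale)
  qed
  have zero: "0 \<in> J" using J by (rule ideal.subspace_0)
  have power: "y v ^ n - y' v ^ n \<in> J" for v n
  proof (induction n)
    case (Suc n)
    then show ?case unfolding power_Suc by (intro mult y)
  qed (simp add: zero)
  have "(\<Prod>v\<in>S. y v ^ lookup m v) - (\<Prod>v\<in>S. y' v ^ lookup m v) \<in> J" for S m
  proof (induction S rule: infinite_finite_induct)
    case (insert v S)
    then show ?case unfolding prod.insert[OF insert.hyps] by (intro mult power)
  qed (simp_all add: zero)
  then have "eval_monom y m - eval_monom y' m \<in> J" for m
    by (simp add: eval_monom_def)
  then have "(\<Sum>m\<in>keys p. Const (lookup p m) * (eval_monom y m - eval_monom y' m)) \<in> J"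
    using J by (intro ideal.subspace_sum ideal.subspace_scale)
  then show ?thesis
    by (simp add: insertion_def right_diff_distrib sum_subtractf)
qed

lemma poly_act_in_ideal:
  fixes J :: "('v, 'k::comm_ring_1) mpoly set"
  assumes J: "ideal.subspace J" and "\<And>j. poly.coeff p j \<in> J"
  shows "poly_act A p v $ i \<in> J"
  using assms(2)
proof (induction p arbitrary: i)
  case 0
  show ?case using ideal.subspace_0[OF J] by simp
next
  case (pCons a p)
  have "poly.coeff p j \<in> J" for j using pCons.prems[of "Suc j"] by simp
  then have "poly_act A p v $ j \<in> J" for j by (rule pCons.IH)
  then have "(\<Sum>j\<in>UNIV. A $ i $ j * poly_act A p v $ j) \<in> J"
    using J by (intro ideal.subspace_sum ideal.subspace_scale)
  moreover have "v $ i * a \<in> J"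
    using pCons.prems[of 0] J by (intro ideal.subspace_scale) simp_all
  ultimately show ?case
    using ideal.subspace_add[OF J] by (simp add: matrix_vector_mult_def mult.commute)
qed

lemma coeff_prod_linear_lessThan:
  "k \<le> n \<Longrightarrow> poly.coeff (\<Prod>i<n. [:- x i, 1:]) (n - k) = elem_fps x {..<n} $$ k"
  using coeff_prod_linear[of "{..<n}" k x] by simp

lemma coeff_prod_linear_greater:
  fixes x :: "nat \<Rightarrow> 'a::comm_ring_1"
  assumes "j > n"
  shows "poly.coeff (\<Prod>i<n. [:- x i, 1:]) j = 0"
proof (rule coeff_eq_0)
  have "degree (\<Prod>i<n. [:- x i, 1:]) \<le> (\<Sum>i<n. degree [:- x i, 1:])"
    using degree_prod_sum_le[of "{..<n}" "\<lambda>i. [:- x i, 1:]"] by (simp add: comp_def)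
  also have "\<dots> \<le> (\<Sum>i<n. 1)" by (intro sum_mono) (simp add: degree_pCons_le)
  finally show "degree (\<Prod>i<n. [:- x i, 1:]) < j" using assms by simp
qed

text \<open>The hypothesis \<open>roots\<close> says that the \<open>r i\<close> are the roots of
  the monic polynomial with coefficients \<open>l 1, ..., l n\<close>.\<close>

locale char_ideal = coordinate_order idx for idx :: "'n::finite \<Rightarrow> nat" +
  fixes l :: "nat \<Rightarrow> int" and r :: "nat \<Rightarrow> 'k::{alg_closed_field, field_char_0}"
  assumes roots: "\<And>k. k \<in> {1..CARD('n)} \<Longrightarrow> elem_fps r {..<CARD('n)} $$ k = of_int (l k)"
begin

abbreviation gen :: "('n coord, 'k) mpoly ^ 'n ^ 'n"
  where "gen \<equiv> generic_matrix"

definition f :: "nat \<Rightarrow> ('n coord, 'k) mpoly"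
  where "f k = a_coeff k gen - Const (of_int (l k)) * Var Z_coord ^ k"

definition J :: "('n coord, 'k) mpoly set"
  where "J = ideal.span (f ` {1..CARD('n)})"

text \<open>On the variety these are the eigenvalues of the matrix: the roots \<open>r k\<close>
  made homogeneous by the last coordinate.\<close>

definition c :: "nat \<Rightarrow> ('n coord, 'k) mpoly"
  where "c k = Var Z_coord * Const (r k)"

definition V :: "('n coord \<Rightarrow> 'k) set set"
  where "V = char_variety l"

lemma subspace_J: "ideal.subspace J"
  unfolding J_def by (rule ideal.subspace_span)

lemma f_in_J: "k \<in> {1..CARD('n)} \<Longrightarrow> f k \<in> J"
  unfolding J_def by (intro ideal.span_base imageI)

lemma f_form:
  assumes "k \<le> CARD('n)"
  shows "f k \<in> forms k"
proof -
  have "(Const (of_int (l k)) * Var Z_coord ^ k :: ('n coord, 'k) mpoly) \<in> forms (0 + k * 1)"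
    by (intro forms_mult forms_Const forms_power forms_Var)
  then show ?thesis
    unfolding f_def using assms by (intro forms_diff a_coeff_generic_form) simp_all
qed

lemma elem_fps_c:
  assumes "k \<in> {1..CARD('n)}"
  shows "elem_fps c {..<CARD('n)} $$ k = Const (of_int (l k)) * Var Z_coord ^ k"
proof -
  interpret h: comm_ring_hom "Const :: 'k \<Rightarrow> ('n coord, 'k) mpoly" by (rule comm_ring_hom_Const)
  show ?thesis
    unfolding c_def using roots[OF assms]
    by (simp add: elem_fps_scale flip: h.hom_elem_fps)
qed

text \<open>Cayley-Hamilton allows the characteristic polynomial to be subtracted from the product
  of the \<open>X - c i\<close>. The leading terms cancel, and the remaining coefficients of the
  difference are the \<open>- f k\<close>.\<close>

lemma krylov_end_in_J: "krylov_end gen c $ i \<in> J"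
proof -
  let ?n = "CARD('n)" and ?P = "\<Prod>i<CARD('n). [:- c i, 1:]"
  have "krylov_end gen c = poly_act gen (?P - char_poly gen) (axis (nth_index 0) 1)"
    by (simp add: krylov_end_def krylov_eq_poly_act poly_act_diff cayley_hamilton)
  moreover have "poly.coeff (?P - char_poly gen) j \<in> J" for j
  proof (cases "j < ?n")
    case True
    define k where "k = ?n - j"
    have k: "k \<in> {1..?n}" "j = ?n - k" using True by (auto simp: k_def)
    then have "poly.coeff (?P - char_poly gen) j = - f k"
      using coeff_prod_linear_lessThan[of k ?n c] elem_fps_c[OF k(1)]
      by (simp add: a_coeff_def f_def)
    then show ?thesis using ideal.subspace_neg[OF subspace_J f_in_J[OF k(1)]] by simp
  next
    case False
    have "poly.coeff (?P - char_poly gen) j = 0"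
    proof (cases "j = ?n")
      case True
      then show ?thesis
        using coeff_prod_linear_lessThan[of 0 ?n c] a_coeff_generic_0[where ?'n = 'n and ?'k = 'k]
        by (simp add: elem_fps_nth_0 a_coeff_def)
    next
      case False
      with \<open>\<not> j < ?n\<close> have "j > ?n" by simp
      then show ?thesis by (simp add: coeff_prod_linear_greater coeff_char_poly_generic_greater)
    qed
    then show ?thesis using ideal.subspace_0[OF subspace_J] by simp
  qed
  ultimately show ?thesis using poly_act_in_ideal[OF subspace_J] by metis
qed

lemma eval_generic: "(\<chi> i j. eval_mpoly y (gen $ i $ j)) = (\<chi> i j. y (Entry i j))"
  by (simp add: generic_matrix_def)

lemma eval_f: "eval_mpoly y (f k) = a_coeff k (\<chi> i j. y (Entry i j)) - of_int (l k) * y Z_coord ^ k"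
proof -
  interpret e: comm_ring_hom "eval_mpoly y" by (rule comm_ring_hom_eval_mpoly)
  show ?thesis by (simp add: f_def e.hom_simps e.hom_a_coeff eval_generic)
qed

lemma V_eq: "V = proj_zeros (f ` {1..CARD('n)})"
  unfolding V_def char_variety_def f_def by (rule arg_cong[of _ _ proj_zeros]) auto

lemma f_in_proj_ideal:
  assumes "k \<in> {1..CARD('n)}"
  shows "f k \<in> proj_ideal V"
proof -
  have "\<forall>P\<in>V. \<forall>x\<in>P. eval_mpoly x (f k) = 0"
    using assms unfolding V_eq proj_zeros_def by blast
  moreover have "f k \<in> forms k" using assms by (intro f_form) simp
  ultimately show ?thesis unfolding proj_ideal_def by (intro ideal.span_base) blast
qed

text \<open>As the \<open>f k\<close> are homogeneous, a nonzero common zero represents a point of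
  \<open>V\<close>; the generating forms of the ideal vanish there, hence so do all its
  elements.\<close>

lemma proj_ideal_vanishes:
  assumes p: "p \<in> proj_ideal V" and y: "y \<noteq> (\<lambda>_. 0)" and zero: "\<And>k. k \<in> {1..CARD('n)} \<Longrightarrow> eval_mpoly y (f k) = 0"
  shows "eval_mpoly y p = 0"
proof -
  interpret e: comm_ring_hom "eval_mpoly y" by (rule comm_ring_hom_eval_mpoly)
  have "proj_point y \<in> V"
    unfolding V_eq proj_zeros_def proj_space_def
    using y zero eval_mpoly_scale_form[OF f_form] by (auto simp: proj_point_def)
  moreover have "y \<in> proj_point y"
    by (auto simp: proj_point_def intro: exI[of _ 1])
  ultimately have "eval_mpoly y q = 0" if "\<forall>P\<in>V. \<forall>x\<in>P. eval_mpoly x q = 0" for q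
    using that by blast
  with p show ?thesis
    unfolding proj_ideal_def
    by (induction rule: ideal.span_induct_alt) (auto simp: e.hom_simps)
qed

text \<open>A point with polynomial coordinates which lies on the variety wherever
  \<open>krylov_det\<close> is nonzero and which, modulo \<open>J\<close>, is
  \<open>krylov_det\<close> times the tautological point.\<close>

definition \<phi> :: "'n coord \<Rightarrow> ('n coord, 'k) mpoly"
  where "\<phi> v = (case v of Entry i j \<Rightarrow> deform gen c $ i $ j | Z_coord \<Rightarrow> krylov_det gen c * Var Z_coord)"

text \<open>After evaluation in the field the common factor of \<open>char_poly_deform\<close> can
  be cancelled. The deformed matrix then has as eigenvalues the \<open>r k\<close> scaled by its
  last coordinate.\<close>

lemma eval_f_deformed:
  assumes D: "eval_mpoly x (krylov_det gen c) \<noteq> 0" and k: "k \<in> {1..CARD('n)}"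
  shows "eval_mpoly (\<lambda>v. eval_mpoly x (\<phi> v)) (f k) = 0"
proof -
  have hom: "comm_ring_hom (eval_mpoly x)" by (rule comm_ring_hom_eval_mpoly)
  then interpret e: comm_ring_hom "eval_mpoly x" .
  define A where "A = (\<chi> i j. x (Entry i j))"
  define c' where "c' = (\<lambda>i. x Z_coord * r i)"
  have c': "(\<lambda>i. eval_mpoly x (c i)) = c'" by (simp add: c_def c'_def e.hom_simps)
  have D': "eval_mpoly x (krylov_det gen c) = krylov_det A c'"
    by (simp add: hom_krylov_det[OF hom] eval_generic c' A_def)
  have def: "eval_mpoly x (deform gen c $ i $ j) = deform A c' $ i $ j" for i j
    by (simp add: hom_deform[OF hom] eval_generic c' A_def)
  have cp: "char_poly (deform A c') = (\<Prod>k<CARD('n). [:- (krylov_det A c' * c' k), 1:])"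
  proof -
    have "smult (krylov_det A c') (char_poly (deform A c') - (\<Prod>k<CARD('n). [:- (krylov_det A c' * c' k), 1:])) = 0"
      unfolding smult_diff_right char_poly_deform by (rule diff_self)
    then show ?thesis using D unfolding D' by (simp only: smult_eq_0_iff right_minus_eq) simp
  qed
  have scale: "(\<lambda>i. krylov_det A c' * c' i) = (\<lambda>i. (krylov_det A c' * x Z_coord) * r i)"
    by (simp add: c'_def mult.assoc)
  have "a_coeff k (deform A c') = (krylov_det A c' * x Z_coord) ^ k * of_int (l k)"
    unfolding a_coeff_def cp using k
    by (subst coeff_prod_linear_lessThan) (simp_all add: scale elem_fps_scale roots)
  moreover have "(\<chi> i j. eval_mpoly x (\<phi> (Entry i j))) = deform A c'"
    by (simp add: \<phi>_def def vec_eq_iff)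
  moreover have "eval_mpoly x (\<phi> Z_coord) = krylov_det A c' * x Z_coord"
    by (simp add: \<phi>_def e.hom_simps D')
  ultimately show ?thesis by (simp add: eval_f)
qed

text \<open>The two extra factors deal with the points where the last coordinate of
  \<open>\<phi>\<close> vanishes. Everywhere else the values of \<open>\<phi>\<close> represent a
  point of \<open>V\<close>.\<close>

lemma proj_ideal_deformed:
  assumes "p \<in> proj_ideal V"
  shows "Var Z_coord * krylov_det gen c * subst_mpoly \<phi> p = 0"
proof (rule mpoly_eq_0_if_eval_eq_0)
  fix x :: "'n coord \<Rightarrow> 'k"
  interpret e: comm_ring_hom "eval_mpoly x" by (rule comm_ring_hom_eval_mpoly)
  let ?y = "\<lambda>v. eval_mpoly x (\<phi> v)"
  show "eval_mpoly x (Var Z_coord * krylov_det gen c * subst_mpoly \<phi> p) = 0"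
  proof (cases "x Z_coord = 0 \<or> eval_mpoly x (krylov_det gen c) = 0")
    case True
    then show ?thesis by (auto simp: e.hom_simps)
  next
    case False
    then have "?y Z_coord \<noteq> 0" by (simp add: \<phi>_def e.hom_simps)
    then have "?y \<noteq> (\<lambda>_. 0)" by metis
    then have "eval_mpoly ?y p = 0"
      using False by (intro proj_ideal_vanishes[OF assms] eval_f_deformed) auto
    then show ?thesis by (simp add: e.hom_simps eval_subst_mpoly)
  qed
qed

text \<open>The rank one correction in \<open>deform\<close> is a multiple of
  \<open>krylov_end\<close>, hence lies in \<open>J\<close>. So modulo \<open>J\<close> the
  polynomial \<open>p\<close> is evaluated at the scaled variables, which by homogeneity gives
  \<open>krylov_det gen c ^ d * p\<close>.\<close>

lemma proj_ideal_reduced: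
  assumes "p \<in> proj_ideal V" "p \<in> forms d"
  shows "Var Z_coord * krylov_det gen c ^ Suc d * p \<in> J"
proof -
  let ?D = "krylov_det gen c"
  have "(?D * Var v) - \<phi> v \<in> J" for v
  proof (cases v)
    case (Entry i j)
    then have "(?D * Var v) - \<phi> v = left_adjugate (krylov_matrix gen c) $ nth_index (CARD('n) - 1) $ j * krylov_end gen c $ i"
      by (simp add: \<phi>_def deform_def generic_matrix_def mult.commute)
    then show ?thesis
      using ideal.subspace_scale[OF subspace_J krylov_end_in_J] by simp
  next
    case Z_coord
    then show ?thesis using ideal.subspace_0[OF subspace_J] by (simp add: \<phi>_def)
  qed
  then have "subst_mpoly (\<lambda>v. ?D * Var v) p - subst_mpoly \<phi> p \<in> J"
    by (rule subst_mpoly_cong_ideal[OF subspace_J])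
  then have "Var Z_coord * ?D * (subst_mpoly (\<lambda>v. ?D * Var v) p - subst_mpoly \<phi> p) \<in> J"
    by (rule ideal.subspace_scale[OF subspace_J])
  then have "Var Z_coord * ?D * subst_mpoly (\<lambda>v. ?D * Var v) p \<in> J"
    unfolding right_diff_distrib proj_ideal_deformed[OF assms(1)] by simp
  also have "subst_mpoly (\<lambda>v. ?D * Var v) p = ?D ^ d * p"
    using subst_mpoly_scale_form[OF assms(2), of ?D Var] by (simp add: subst_mpoly_Var_eq)
  finally show ?thesis by (simp only: power_Suc mult.assoc)
qed

end

section \<open>Dominant monomials of the generators\<close>

lemma lookup_restrict_mpoly:
  fixes p :: "('v::finite, 'k::comm_ring_1) mpoly"
  shows "lookup (subst_mpoly (\<lambda>v. if good v then Var v else 0) p) k =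
    (if \<forall>v. good v \<or> lookup k v = 0 then lookup p k else 0)"
proof -
  let ?y = "\<lambda>v. if good v then Var v else (0 :: ('v, 'k) mpoly)"
  have y: "eval_monom ?y m = (if \<forall>v. good v \<or> lookup m v = 0 then Poly_Mapping.single m 1 else 0)" for m
  proof (cases "\<forall>v. good v \<or> lookup m v = 0")
    case True
    then have "eval_monom ?y m = eval_monom Var m"
      unfolding eval_monom_def by (intro prod.cong) auto
    then show ?thesis using True by (simp add: eval_monom_Var)
  next
    case False
    then obtain v where "\<not> good v" "lookup m v \<noteq> 0" by blast
    then have "eval_monom ?y m = 0"
      unfolding eval_monom_def by (intro prod_zero bexI[of _ v]) (auto simp: power_0_left)
    then show ?thesis by (simp only: False if_False)
  qed
  have "lookup (subst_mpoly ?y p) k = (\<Sum>m\<in>keys p. if m = k then (if \<forall>v. good v \<or> lookup k v = 0 then lookup p k else 0) else 0)"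
    unfolding insertion_def lookup_sum
    by (intro sum.cong) (auto simp: y Const_def mult_single lookup_single)
  then show ?thesis by (simp add: in_keys_iff)
qed

text \<open>
  A monomial containing a variable outside \<open>good\<close> is too light to compete with \<open>m\<close>.
\<close>

lemma dominant_if_dominant_restrict:
  fixes p :: "('v::finite, 'k::comm_ring_1) mpoly"
  assumes p: "p \<in> forms e" and W: "\<And>v. W v \<le> w" "\<And>v. \<not> good v \<Longrightarrow> W v = 0"
    and dom: "dominant W (subst_mpoly (\<lambda>v. if good v then Var v else 0) p) m"
    and less: "e * w < weight W m + w"
  shows "dominant W p m"
proof (rule dominantI)
  let ?q = "subst_mpoly (\<lambda>v. if good v then Var v else 0) p"
  show "lookup p m = 1"
    using dominant_lookup[OF dom] by (simp add: lookup_restrict_mpoly split: if_splits)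
  fix k assume k: "k \<in> keys p" "k \<noteq> m"
  show "weight W k < weight W m"
  proof (cases "\<forall>v. good v \<or> lookup k v = 0")
    case True
    then have "lookup ?q k \<noteq> 0" using k by (simp add: lookup_restrict_mpoly in_keys_iff)
    then show ?thesis using dominant_lookup_other[OF dom k(2)] not_le by blast
  next
    case False
    then obtain u where u: "\<not> good u" "lookup k u \<noteq> 0" by blast
    \<comment> \<open>Each occurrence of \<open>u\<close> weighs 0 instead of the permitted
      \<open>w\<close>, so \<open>k\<close> loses at least one \<open>w\<close> against the maximal
      weight \<open>e * w\<close>.\<close>
    have "weight W k + w \<le> (\<Sum>v\<in>UNIV - {u}. W v * lookup k v) + w * lookup k u"
      using u W(2)[of u] unfolding weight_def by (subst sum.remove[of _ u]) auto
    also have "\<dots> \<le> (\<Sum>v\<in>UNIV - {u}. w * lookup k v) + w * lookup k u"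
      by (intro add_mono sum_mono mult_right_mono W) auto
    also have "\<dots> = (\<Sum>v\<in>UNIV. w * lookup k v)"
      by (subst (2) sum.remove[of _ u]) auto
    also have "\<dots> = e * w"
      using p k(1) by (auto simp: forms_def monom_degree_altdef mult.commute simp flip: sum_distrib_left)
    finally show ?thesis using less by simp
  qed
qed

lemma Var_neq_0: "(Var v :: ('v, 'k::comm_ring_1) mpoly) \<noteq> 0"
proof
  assume "(Var v :: ('v, 'k) mpoly) = 0"
  then have "keys (Var v :: ('v, 'k) mpoly) = {}" by simp
  then show False by (simp add: Var_def del: keys_eq_empty)
qed

lemma weight_sum: "weight W (\<Sum>x\<in>S. m x) = (\<Sum>x\<in>S. weight W (m x))"
  by (induction S rule: infinite_finite_induct) (auto simp: weight_add)

lemma forms_det: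
  fixes A :: "('v::finite, 'k::comm_ring_1) mpoly ^ 'n::finite ^ 'n"
  assumes "\<And>i j. A $ i $ j \<in> forms (e j)"
  shows "det A \<in> forms (\<Sum>j\<in>UNIV. e j)"
  unfolding det_def
proof (rule forms_sum)
  fix p :: "'n \<Rightarrow> 'n" assume "p \<in> {p. p permutes UNIV}"
  then have "(\<Sum>i\<in>UNIV. e (p i)) = (\<Sum>i\<in>UNIV. e i)"
    by (intro sum.reindex_bij_betw) (simp add: permutes_bij)
  moreover have "(\<Prod>i\<in>UNIV. A $ i $ p i) \<in> forms (\<Sum>i\<in>UNIV. e (p i))"
    by (intro forms_prod assms)
  ultimately show "of_int (sign p) * (\<Prod>i\<in>UNIV. A $ i $ p i) \<in> forms (\<Sum>i\<in>UNIV. e i)"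
    using of_int_sign_mult[of p "\<Prod>i\<in>UNIV. A $ i $ p i"] by (auto intro: forms_uminus)
qed

context char_ideal
begin

text \<open>Keeping only these variables makes the generic matrix lower bidiagonal, and both the
  characteristic polynomial and the Krylov determinant become explicit.\<close>

definition good :: "'n coord \<Rightarrow> bool"
  where "good v = (case v of Entry i j \<Rightarrow> i = j \<or> idx i = Suc (idx j) | Z_coord \<Rightarrow> False)"

text \<open>Large enough for \<open>(i + 1) * i < N\<close> at every index \<open>i < n\<close>:
  this is the amount by which the power \<open>i + 1\<close> of a diagonal variable falls short of
  the maximal weight.\<close>

definition N :: nat
  where "N = CARD('n) * CARD('n) + CARD('n)"

text \<open>Subdiagonal variables get the maximal weight, which makes the monomial of the Krylov
  determinant dominant. Diagonal weights decrease slightly with the index, so that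
  \<open>x i\<close> is the heaviest of the \<open>x j\<close> with \<open>j\<close> in
  \<open>upper i\<close>.\<close>

definition W :: "'n coord \<Rightarrow> nat"
  where "W v = (case v of Entry i j \<Rightarrow> if i = j then N - idx i else if idx i = Suc (idx j) then N else 0
    | Z_coord \<Rightarrow> 0)"

abbreviation restrict :: "('n coord, 'k) mpoly \<Rightarrow> ('n coord, 'k) mpoly"
  where "restrict \<equiv> subst_mpoly (\<lambda>v. if good v then Var v else 0)"

definition x :: "'n \<Rightarrow> ('n coord, 'k) mpoly"
  where "x i = Var (Entry i i)"

definition upper :: "'n \<Rightarrow> 'n set"
  where "upper i = {j. idx i \<le> idx j}"

text \<open>
  These are the combinations of the \<open>f k\<close> in which restriction leaves only the complete
  symmetric polynomial of degree \<open>idx i + 1\<close> in the variables \<open>x j\<close> for \<open>j \<in> upper i\<close>.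
\<close>

definition g :: "'n \<Rightarrow> ('n coord, 'k) mpoly"
  where "g i = - (\<Sum>k\<in>{1..Suc (idx i)}. f k * complete_fps x (upper i) $$ (Suc (idx i) - k))"

lemma W_le: "W v \<le> N"
  by (auto simp: W_def split: coord.split)

lemma W_not_good: "\<not> good v \<Longrightarrow> W v = 0"
  by (auto simp: W_def good_def split: coord.splits)

lemma hom_restrict: "comm_ring_hom restrict"
  by (rule comm_ring_hom_subst)

lemma restrict_generic:
  "(\<chi> i j. restrict (gen $ i $ j)) = (\<chi> i j. if i = j \<or> idx i = Suc (idx j) then Var (Entry i j) else 0)"
  by (simp add: generic_matrix_def good_def vec_eq_iff)

lemma restrict_Z: "restrict (Var Z_coord) = 0"
  by (simp add: good_def)

text \<open>Restriction sends the last coordinate to 0, which removes the term with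
  \<open>l k\<close> because \<open>k \<ge> 1\<close>, and makes the matrix triangular with diagonal
  \<open>x\<close>.\<close>

lemma restrict_f:
  assumes k: "k \<in> {1..CARD('n)}"
  shows "restrict (f k) = elem_fps x UNIV $$ k"
proof -
  interpret h: comm_ring_hom restrict by (rule hom_restrict)
  let ?A = "(\<chi> i j. if i = j \<or> idx i = Suc (idx j) then Var (Entry i j) else 0) :: ('n coord, 'k) mpoly ^ 'n ^ 'n"
  have "char_poly ?A = (\<Prod>i\<in>UNIV. [:- x i, 1:])"
    by (subst char_poly_triangular[OF inj_idx]) (auto simp: x_def)
  then have "a_coeff k ?A = elem_fps x UNIV $$ k"
    using k by (simp add: a_coeff_def coeff_prod_linear)
  then show ?thesis
    using k by (simp add: f_def h.hom_diff h.hom_mult h.hom_power restrict_Z h.hom_a_coeff restrict_generic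
        power_0_left del: insertion_Var subst_mpoly_Var)
qed

text \<open>The elementary series of all variables times the complete series of
  \<open>upper i\<close> is the elementary series of the \<open>idx i\<close> other variables, which
  has no coefficient of degree \<open>idx i + 1\<close>. Solving for the complete symmetric term
  gives the claim.\<close>

lemma restrict_g: "restrict (g i) = complete_fps x (upper i) $$ Suc (idx i)"
proof -
  interpret h: comm_ring_hom restrict by (rule hom_restrict)
  let ?K = "Suc (idx i)" and ?E = "elem_fps x UNIV" and ?H = "complete_fps x (upper i)"
  have H: "restrict (?H $$ m) = ?H $$ m" for m
  proof -
    have "(\<lambda>j. restrict (x j)) = x" by (simp add: fun_eq_iff x_def good_def)
    then show ?thesis unfolding h.hom_complete_fps[OF finite] by simp
  qed
  have "elem_fps x UNIV = elem_fps x (UNIV - upper i) * elem_fps x (upper i)"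
    unfolding elem_fps_def by (rule prod.subset_diff) auto
  then have EH: "?E * ?H = elem_fps x (UNIV - upper i)"
    by (simp add: mult.assoc elem_mult_complete)
  have "idx ` (UNIV - upper i) \<subseteq> {..<idx i}" by (auto simp: upper_def)
  then have "card (UNIV - upper i) \<le> card {..<idx i}"
    by (intro card_inj_on_le[of idx]) (auto intro: inj_on_subset[OF inj_idx])
  then have "0 = (?E * ?H) $$ ?K"
    unfolding EH by (intro elem_fps_nth_greater[symmetric]) auto
  also have "\<dots> = ?H $$ ?K + (\<Sum>k\<in>{1..?K}. ?E $$ k * ?H $$ (?K - k))"
    by (simp add: fps_mult_nth sum.atLeast_Suc_atMost[of 0] elem_fps_nth_0)
  also have "(\<Sum>k\<in>{1..?K}. ?E $$ k * ?H $$ (?K - k)) = (\<Sum>k\<in>{1..?K}. restrict (f k) * restrict (?H $$ (?K - k)))"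
    using idx_less[of i] by (intro sum.cong) (simp_all add: restrict_f H)
  also have "\<dots> = - restrict (g i)"
    by (simp add: g_def h.hom_simps)
  finally show ?thesis by simp
qed

lemma g_form: "g i \<in> forms (Suc (idx i))"
  unfolding g_def
proof (intro forms_uminus forms_sum)
  fix k assume k: "k \<in> {1..Suc (idx i)}"
  have "x j \<in> forms 1" for j unfolding x_def by (rule forms_Var)
  then have "f k * complete_fps x (upper i) $$ (Suc (idx i) - k) \<in> forms (k + (Suc (idx i) - k))"
    using k idx_less[of i] by (intro forms_mult f_form complete_fps_form) auto
  then show "f k * complete_fps x (upper i) $$ (Suc (idx i) - k) \<in> forms (Suc (idx i))"
    using k by simp
qed

lemma dominant_g: "dominant W (g i) (Poly_Mapping.single (Entry i i) (Suc (idx i)))"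
proof (rule dominant_if_dominant_restrict[OF g_form W_le W_not_good])
  have up: "upper i = insert i {j. idx i < idx j}"
    by (auto simp: upper_def order_le_less)
  have N: "CARD('n) \<le> N" by (simp add: N_def)
  have x: "x = (\<lambda>i. Var (Entry i i))" by (simp add: fun_eq_iff x_def)
  show "dominant W (restrict (g i)) (Poly_Mapping.single (Entry i i) (Suc (idx i)))"
    unfolding restrict_g up x
  proof (rule dominant_complete_fps)
    fix j assume "j \<in> {j. idx i < idx j}"
    then show "W (Entry j j) < W (Entry i i)"
      using idx_less[of j] N by (simp add: W_def)
  qed auto
  \<comment> \<open>This is the gap in weight that rules out the monomials lost by restriction; it
    is where the size of \<open>N\<close> enters.\<close>
  have "(idx i + 1) * idx i \<le> CARD('n) * CARD('n)"
    using idx_less[of i] by (intro mult_mono) auto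
  then have "Suc (idx i) * idx i < N"
    using idx_less[of i] by (simp add: N_def)
  moreover have "idx i \<le> N" using idx_less[of i] N by simp
  ultimately show "Suc (idx i) * N < weight W (Poly_Mapping.single (Entry i i) (Suc (idx i))) + N"
    by (simp add: W_def diff_mult_distrib diff_mult_distrib2 algebra_simps)
qed

lemma g_in_ideal:
  assumes I: "ideal.subspace I" and f: "\<And>k. k \<in> {1..CARD('n)} \<Longrightarrow> f k \<in> I"
  shows "g i \<in> I"
  unfolding g_def
proof (intro ideal.subspace_neg[OF I] ideal.subspace_sum[OF I])
  fix k assume "k \<in> {1..Suc (idx i)}"
  then have "f k \<in> I" using idx_less[of i] by (intro f) auto
  then show "f k * complete_fps x (upper i) $$ (Suc (idx i) - k) \<in> I"
    using ideal.subspace_scale[OF I] by (metis mult.commute)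
qed

text \<open>The \<open>g\<close> are obtained from the \<open>f\<close> by a triangular system:
  \<open>g i\<close> contains \<open>f (idx i + 1)\<close> with coefficient \<open>-1\<close> and
  otherwise only earlier \<open>f j\<close>, so the system can be solved recursively.\<close>

lemma f_in_ideal_g:
  assumes "k \<in> {1..CARD('n)}"
  shows "f k \<in> ideal.span (range g)"
  using assms
proof (induction k rule: less_induct)
  case (less k)
  define i where "i = nth_index (k - 1)"
  have i: "Suc (idx i) = k" using less.prems idx_nth_index[of "k - 1"] by (simp add: i_def) linarith
  have "{1..k} = insert k {1..<k}" using less.prems by auto
  then have "f k = - g i - (\<Sum>j\<in>{1..<k}. f j * complete_fps x (upper i) $$ (k - j))"
    unfolding g_def i by (simp add: complete_fps_nth_0)
  moreover have "(\<Sum>j\<in>{1..<k}. f j * complete_fps x (upper i) $$ (k - j)) \<in> ideal.span (range g)"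
  proof (rule ideal.span_sum)
    fix j assume "j \<in> {1..<k}"
    then have "f j \<in> ideal.span (range g)" using less.prems by (intro less.IH) auto
    then show "f j * complete_fps x (upper i) $$ (k - j) \<in> ideal.span (range g)"
      using ideal.span_scale by (metis mult.commute)
  qed
  moreover have "- g i \<in> ideal.span (range g)"
    by (intro ideal.span_neg ideal.span_base) simp
  ultimately show ?case
    by (simp only: ideal.span_diff)
qed

lemma J_subset: "J \<subseteq> ideal.span (range g)"
  unfolding J_def using f_in_ideal_g by (intro ideal.span_minimal) auto

section \<open>The dominant monomial of the Krylov determinant\<close>

definition subdiagonal :: "nat \<Rightarrow> 'n coord"
  where "subdiagonal j = Entry (nth_index (Suc j)) (nth_index j)"

text \<open>The product of the diagonal of the restricted Krylov matrix, whose entry at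
  \<open>i\<close> is the product of the first \<open>idx i\<close> subdiagonal variables.\<close>

definition \<mu> :: "'n coord \<Rightarrow>\<^sub>0 nat"
  where "\<mu> = (\<Sum>i\<in>UNIV. \<Sum>j<idx i. Poly_Mapping.single (subdiagonal j) 1)"

text \<open>With zero shifts the vector is the \<open>k\<close>-th power of \<open>A\<close> applied
  to the first unit vector. In \<open>k\<close> steps of a lower bidiagonal matrix an index beyond
  \<open>k\<close> is out of reach, and \<open>k\<close> itself is reached only by moving down at
  every step.\<close>

lemma krylov_bidiagonal:
  fixes A :: "('n coord, 'k) mpoly ^ 'n ^ 'n"
  defines "A \<equiv> (\<chi> i j. if i = j \<or> idx i = Suc (idx j) then Var (Entry i j) else 0)"
  assumes "k \<le> idx i"
  shows "krylov A (\<lambda>_. 0) (axis (nth_index 0) 1) k $ i = (if idx i = k then \<Prod>j<k. Var (subdiagonal j) else 0)"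
  using assms(2)
proof (induction k arbitrary: i)
  case 0
  have "idx (nth_index 0) = 0" by (simp add: idx_nth_index)
  then have "idx i = 0 \<longleftrightarrow> i = nth_index 0" using idx_eq_iff[of i "nth_index 0"] by simp
  then show ?case by (simp add: axis_def)
next
  case (Suc k)
  let ?v = "krylov A (\<lambda>_. 0) (axis (nth_index 0) 1) k"
  have k: "k < CARD('n)" "idx (nth_index k) = k"
    using Suc.prems idx_less[of i] by (auto intro!: idx_nth_index)
  have "A $ i $ j * ?v $ j = (if j = nth_index k then (if idx i = Suc k then Var (subdiagonal k) * (\<Prod>j<k. Var (subdiagonal j)) else 0) else 0)" for j
  proof (cases "A $ i $ j = 0")
    case True
    then have "j = nth_index k \<Longrightarrow> idx i \<noteq> Suc k"
      using k by (auto simp: A_def Var_neq_0)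
    then show ?thesis using True by auto
  next
    case False
    then have j: "i = j \<or> idx i = Suc (idx j)" by (auto simp: A_def split: if_splits)
    then have "k \<le> idx j" using Suc.prems by auto
    then have v: "?v $ j = (if idx j = k then \<Prod>j<k. Var (subdiagonal j) else 0)" by (rule Suc.IH)
    show ?thesis
    proof (cases "idx j = k")
      case True
      then have "j = nth_index k" using nth_index_idx[of j] by simp
      moreover have "idx i = Suc k" using j True Suc.prems by auto
      moreover have "nth_index (Suc k) = i" using calculation nth_index_idx[of i] by simp
      ultimately show ?thesis using v True by (simp add: A_def subdiagonal_def)
    next
      case False
      then show ?thesis using v k by auto
    qed
  qed
  then show ?case
    by (simp add: matrix_vector_mult_def mult.commute)
qed

lemma restrict_krylov_det:
  "restrict (krylov_det gen c) = (\<Prod>i\<in>UNIV. \<Prod>j<idx i. Var (subdiagonal j))"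
proof -
  interpret h: comm_ring_hom restrict by (rule hom_restrict)
  let ?A = "(\<chi> i j. if i = j \<or> idx i = Suc (idx j) then Var (Entry i j) else 0) :: ('n coord, 'k) mpoly ^ 'n ^ 'n"
  have c: "restrict (c i) = 0" for i
    by (simp add: c_def h.hom_mult restrict_Z del: subst_mpoly_Var)
  have "restrict (krylov_det gen c) = det (krylov_matrix ?A (\<lambda>_. 0))"
    unfolding hom_krylov_det[OF hom_restrict] restrict_generic c by (simp add: krylov_det_def)
  also have "\<dots> = (\<Prod>i\<in>UNIV. krylov_matrix ?A (\<lambda>_. 0) $ i $ i)"
  \<comment> \<open>The ranks are reversed because the Krylov matrix is upper triangular in the
    order of \<open>idx\<close>.\<close>
  proof (rule det_triangular[of "\<lambda>i. CARD('n) - idx i"])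
    show "inj (\<lambda>i. CARD('n) - idx i)"
    proof (rule injI)
      fix i j assume "CARD('n) - idx i = CARD('n) - idx j"
      then have "idx i = idx j" using idx_less[of i] idx_less[of j] by linarith
      then show "i = j" by simp
    qed
    fix i j assume "CARD('n) - idx i < CARD('n) - idx j"
    then have "idx j < idx i" "i \<noteq> j" by auto
    then show "krylov_matrix ?A (\<lambda>_. 0) $ i $ j = 0"
      unfolding krylov_matrix_def by (simp add: krylov_bidiagonal del: krylov.simps)
  qed
  also have "\<dots> = (\<Prod>i\<in>UNIV. \<Prod>j<idx i. Var (subdiagonal j))"
    unfolding krylov_matrix_def by (simp add: krylov_bidiagonal)
  finally show ?thesis .
qed

lemma krylov_form: "krylov gen c (axis k 1) m $ i \<in> forms m"
proof (induction m arbitrary: i)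
  case 0
  show ?case by (simp add: axis_def forms_1)
next
  case (Suc m)
  have "c m \<in> forms (1 + 0)"
    unfolding c_def by (intro forms_mult forms_Var forms_Const)
  then have "c m * krylov gen c (axis k 1) m $ i \<in> forms (1 + m)"
    by (intro forms_mult Suc) simp
  moreover have "(\<Sum>j\<in>UNIV. gen $ i $ j * krylov gen c (axis k 1) m $ j) \<in> forms (1 + m)"
    by (intro forms_sum forms_mult generic_matrix_form Suc)
  ultimately show ?case
    by (simp add: matrix_vector_mult_def forms_diff)
qed

lemma dominant_krylov_det: "dominant W (krylov_det gen c) \<mu>"
proof (rule dominant_if_dominant_restrict[OF _ W_le W_not_good])
  show "krylov_det gen c \<in> forms (\<Sum>i\<in>UNIV. idx i)"
    unfolding krylov_det_def by (rule forms_det) (simp add: krylov_matrix_def krylov_form)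
  show "dominant W (restrict (krylov_det gen c)) \<mu>"
    unfolding restrict_krylov_det \<mu>_def by (intro dominant_prod dominant_Var)
  \<comment> \<open>All variables of \<open>\<mu>\<close> have the maximal weight, so
    \<open>\<mu>\<close> attains the maximal weight of its degree, and any positive gap is
    enough.\<close>
  have "W (subdiagonal j) = N" if "j < idx i" for i j
  proof -
    have "Suc j < CARD('n)" using that idx_less[of i] by simp
    then have "idx (nth_index (Suc j)) = Suc (idx (nth_index j))" by (simp add: idx_nth_index)
    then show ?thesis by (auto simp: W_def subdiagonal_def)
  qed
  then have "weight W \<mu> = (\<Sum>i\<in>UNIV. idx i) * N"
    by (simp add: \<mu>_def weight_sum sum_distrib_right)
  then show "(\<Sum>i\<in>UNIV. idx i) * N < weight W \<mu> + N"
    by (simp add: N_def)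
qed

text \<open>A subdiagonal entry joins two distinct indices. This is the condition under which
  multiplication by the Krylov determinant preserves standard dominant monomials.\<close>

lemma lookup_\<mu>_diagonal: "lookup \<mu> (Entry i i) = 0"
proof -
  have "subdiagonal j \<noteq> Entry i i" if "j < idx k" for j k
  proof -
    have "Suc j < CARD('n)" using that idx_less[of k] by simp
    then have "idx (nth_index (Suc j)) \<noteq> idx (nth_index j)" by (simp add: idx_nth_index)
    then show ?thesis by (auto simp: subdiagonal_def)
  qed
  then show ?thesis by (simp add: \<mu>_def lookup_sum lookup_single)
qed

section \<open>The degree of the variety, given the roots of the prescribed polynomial\<close>

definition b :: "'n coord \<Rightarrow> nat"
  where "b v = (case v of Entry i j \<Rightarrow> if i = j then Suc (idx i) else 0 | Z_coord \<Rightarrow> 0)"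

definition gen_at :: "'n coord \<Rightarrow> ('n coord, 'k) mpoly"
  where "gen_at v = (case v of Entry i j \<Rightarrow> g i | Z_coord \<Rightarrow> 0)"

lemma b_pos: "{v. b v > 0} = (\<lambda>i. Entry i i) ` UNIV"
proof (intro equalityI subsetI)
  fix v assume "v \<in> {v. b v > 0}"
  then show "v \<in> (\<lambda>i. Entry i i) ` UNIV"
    by (cases v) (auto simp: b_def split: if_splits)
qed (auto simp: b_def)

lemma b_posE:
  assumes "b v > 0"
  obtains i where "v = Entry i i"
  using assms b_pos by auto

lemma proj_degree_V: "proj_degree V = fact CARD('n)"
proof -
  interpret B: adapted_basis W b gen_at
  proof
    fix v assume "b v > 0"
    then obtain i where v: "v = Entry i i" by (rule b_posE)
    show "dominant W (gen_at v) (Poly_Mapping.single v (b v))"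
      using dominant_g[of i] by (simp add: v b_def gen_at_def)
    show "gen_at v \<in> forms (b v)"
      using g_form[of i] by (simp add: v b_def gen_at_def)
  qed
  have span: "gen_at ` {v. b v > 0} = range g"
    by (simp add: b_pos image_image gen_at_def)
  have "proj_degree V = (\<Prod>v | b v > 0. of_nat (b v))"
  proof (rule B.proj_degree_eq)
    fix v assume "b v > 0"
    then obtain i where v: "v = Entry i i" by (rule b_posE)
    have "g i \<in> proj_ideal V"
    proof (rule g_in_ideal)
      show "ideal.subspace (proj_ideal V)"
        unfolding proj_ideal_def by (rule ideal.subspace_span)
    qed (rule f_in_proj_ideal)
    then show "gen_at v \<in> proj_ideal V" by (simp add: v gen_at_def)
  next
    fix p d assume p: "p \<in> proj_ideal V \<inter> forms d"
    let ?m = "Poly_Mapping.single Z_coord 1 + (\<Sum>_<Suc d. \<mu>)" and ?Y = "Var Z_coord * krylov_det gen c ^ Suc d"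
    have "dominant W ?Y ?m"
      by (intro dominant_mult dominant_Var dominant_power dominant_krylov_det)
    moreover have "lookup ?m v = 0" if bv: "b v > 0" for v
    proof -
      obtain i where v: "v = Entry i i" using bv by (rule b_posE)
      show ?thesis
        unfolding v lookup_add lookup_sum lookup_\<mu>_diagonal by (simp add: lookup_single)
    qed
    moreover have "?Y * p \<in> ideal.span (gen_at ` {v. b v > 0})"
      unfolding span using J_subset proj_ideal_reduced[of p d] p by blast
    ultimately show "\<exists>\<mu> Z. dominant W Z \<mu> \<and> (\<forall>v. b v > 0 \<longrightarrow> lookup \<mu> v = 0) \<and>
        Z * p \<in> ideal.span (gen_at ` {v. b v > 0})"
      by blast
  next
    show "b Z_coord = 0" by (simp add: b_def)
  qed
  also have "\<dots> = (\<Prod>i\<in>UNIV. of_nat (Suc (idx i)))"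
    unfolding b_pos by (subst prod.reindex) (auto simp: inj_on_def b_def)
  also have "\<dots> = (\<Prod>k<CARD('n). of_nat (Suc k))" by (rule prod_idx)
  also have "\<dots> = fact CARD('n)"
    by (simp add: fact_prod_Suc atLeast0LessThan)
  finally show ?thesis .
qed

end

section \<open>Splitting the prescribed polynomial, and conclusion\<close>

lemma exists_roots:
  fixes l :: "nat \<Rightarrow> int"
  shows "\<exists>r :: nat \<Rightarrow> 'k::alg_closed_field. \<forall>k\<in>{1..n}. elem_fps r {..<n} $$ k = of_int (l k)"
proof -
  \<comment> \<open>The value at 0 is set to 1, whatever \<open>l 0\<close> is, to make the
    polynomial monic.\<close>
  define a :: "nat \<Rightarrow> 'k" where "a k = (if k = 0 then 1 else of_int (l k))" for k
  define p :: "'k poly" where "p = (\<Sum>i\<le>n. Polynomial.monom (a (n - i)) i)"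
  have coeff: "poly.coeff p j = (if j \<le> n then a (n - j) else 0)" for j
    by (simp add: p_def coeff_sum)
  have "degree p = n"
  proof (rule antisym)
    show "degree p \<le> n" by (rule degree_le) (simp add: coeff)
    show "n \<le> degree p" by (rule le_degree) (simp add: coeff a_def)
  qed
  then have lead: "lead_coeff p = 1" by (simp add: coeff a_def)
  then have "p \<noteq> 0" by auto
  then obtain A where A: "size A = n" "p = (\<Prod>x\<in>#A. [:- x, 1:])"
    using alg_closed_imp_factorization[of p] lead \<open>degree p = n\<close> by auto
  \<comment> \<open>Listing the multiset of roots provides the numbering by
    \<open>i < n\<close>.\<close>
  obtain xs where xs: "mset xs = A" using ex_mset by blast
  have "p = (\<Prod>x\<leftarrow>xs. [:- x, 1:])"
    unfolding A(2) xs[symmetric] by (simp add: prod_mset_prod_list[symmetric])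
  also have "\<dots> = (\<Prod>i<length xs. [:- (xs ! i), 1:])"
    by (simp add: prod.list_conv_set_nth atLeast0LessThan)
  also have "length xs = n" using A(1) xs by auto
  finally have p: "p = (\<Prod>i<n. [:- (xs ! i), 1:])" .
  have "elem_fps (\<lambda>i. xs ! i) {..<n} $$ k = of_int (l k)" if k: "k \<in> {1..n}" for k
  proof -
    have "n - (n - k) = k" using k by simp
    then have "poly.coeff p (n - k) = of_int (l k)" using k by (simp only: coeff) (simp add: a_def)
    then show ?thesis
      using coeff_prod_linear_lessThan[of k n "\<lambda>i. xs ! i"] k p by simp
  qed
  then show ?thesis by blast
qed

theorem propositionA3:
  fixes l :: "nat \<Rightarrow> int"
  shows "proj_degree (char_variety l :: ('n::finite coord \<Rightarrow> 'k::{alg_closed_field, field_char_0}) set set)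
    = fact CARD('n)"
proof -
  \<comment> \<open>Any enumeration of the index type will do, since the variety does not depend on
    it.\<close>
  obtain idx :: "'n \<Rightarrow> nat" where idx: "bij_betw idx UNIV {..<CARD('n)}"
    using ex_bij_betw_finite_nat[of "UNIV :: 'n set"] by (auto simp: atLeast0LessThan)
  obtain r :: "nat \<Rightarrow> 'k" where r: "\<forall>k\<in>{1..CARD('n)}. elem_fps r {..<CARD('n)} $$ k = of_int (l k)"
    using exists_roots by blast
  interpret char_ideal idx l r
    using idx r by unfold_locales auto
  show ?thesis using proj_degree_V by (simp add: V_def)
qed

end
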